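(* Let $(M,h)$ be a 6-dimensional, connected, simply connected, homogeneous, non-flat Einstein manifold of nonpositive sectional curvature. Then there are no left invariant coupled $\mathrm{SU}(3)$-structures on $M$ inducing the Einstein metric $h$, where left invariance refers to the identification of $(M,h)$ with a solvmanifold described in the context.
   Context: Stable forms. Let $V$ be a 6-dimensional real vector space. A 2-form $\omega$ on $V$ is stable if and only if $\omega^3\neq 0$. Let $A:\Lambda^5(V^* )\to V\otimes\Lambda^6(V^* )$ be the isomorphism $A(\gamma)=v\otimes\Omega$ where $i_v\Omega=\gamma$. For $\rho\in\Lambda^3(V^* )$ put $K_\rho:V\to V\otimes\Lambda^6(V^* )$, $K_\rho(v)=A((i_v\rho)\wedge\rho)$, and $\lambda(\rho)=\frac16\mathrm{tr}K_\rho^2\in(\Lambda^6(V^* ))^{\otimes 2}$. A 3-form $\rho$ is stable if and only if $\lambda(\rho)\neq 0$. Orient $V$ so that $\omega^3$ is positive, and let $\sqrt{|\lambda(\rho)|}\in\Lambda^6(V^* )$ be the corresponding positive volume form; then $J_\rho=-\frac{1}{\sqrt{|\lambda(\rho)|}}K_\rho$ is an almost complex structure when $\lambda(\rho)<0$. $\mathrm{SU}(3)$-structures. An $\mathrm{SU}(3)$-structure on a 6-dimensional manifold $M$ is a pair $(\omega,\psi_+)$ of a 2-form and a 3-form on $M$ which at each point are stable with $\lambda(\psi_+)<0$, are compatible ($\omega\wedge\psi_+=0$), satisfy the normalization condition $\psi_+\wedge\psi_-=\frac23\omega^3$, where $J=J_{\psi_+}$ and $\psi_-=J^*\psi_+$,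 and are such that $\omega(\cdot,J\cdot)$ is a Riemannian metric, called the induced metric. It is half-flat if $d\psi_+=0$ and $d(\omega\wedge\omega)=0$; a half-flat structure is coupled if $d\omega=c\,\psi_+$ for some non-vanishing function $c$. Identification with a solvmanifold. A solvmanifold is a simply connected solvable Lie group with a left invariant metric; it is determined by its metric Lie algebra. By a known theorem of Nikitenko and Nikonorov, every $(M,h)$ as in the claim is isometric to the solvmanifold of one of the metric Lie algebras below (for some $r>0$, with $\mathrm{Ric}(h)=-r^2h$): $\mathfrak{s}_5$, $\mathfrak{s}_8$, or, in the symmetric case, $\mathfrak{s}_1$, $\mathfrak{s}_9$, $\mathfrak{s}_{10}$ with $t=\frac{1}{\sqrt{22}}$, $\mathfrak{s}_{11}$, $\mathfrak{s}_{12}$ with $(s,t)=(0,0)$ or $(1,1)$, $\mathfrak{s}_{13}$. "Left invariant on $M$" means left invariant with respect to this solvable Lie group. Each metric Lie algebra has an orthonormal basis with dual basis $(e^1,\ldots,e^6)$, $h=\sum_i(e^i)^2$, $e^{ij}=e^i\wedge e^j$, and structure equations $(de^1,\ldots,de^6)$ (Chevalley-Eilenberg differential): $\mathfrak{s}_1$: $\left(\frac{r}{2\sqrt{2}}e^{16},\ \frac{r}{2\sqrt{2}}e^{26},\ \frac{r}{2\sqrt{2}}e^{36},\ \frac{r}{2\sqrt{2}}e^{46},\ -\frac{r}{\sqrt{2}}e^{12}-\frac{r}{\sqrt{2}}e^{34}+\frac{r}{\sqrt{2}}e^{56},\ 0\right)$ $\mathfrak{s}_5$: $\left(\frac{r}{3\sqrt{2}}e^{16},\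 \frac{r}{2\sqrt{2}}e^{26},\ \frac{r}{2\sqrt{2}}e^{36},\ -\frac{r}{\sqrt{2}}e^{12}+\frac{5r}{6\sqrt{2}}e^{46},\ -\frac{r}{\sqrt{2}}e^{13}+\frac{5r}{6\sqrt{2}}e^{56},\ 0\right)$ $\mathfrak{s}_8$: $\left(r\sqrt{\frac{2}{21}}e^{16},\ r\sqrt{\frac{2}{21}}e^{26},\ -r\sqrt{\frac23}e^{12}+2r\sqrt{\frac{2}{21}}e^{36},\ r\sqrt{\frac{3}{14}}e^{46},\ r\sqrt{\frac{3}{14}}e^{56},\ 0\right)$ $\mathfrak{s}_9$: $\left(\frac{r}{\sqrt{5}}e^{16},\ \frac{r}{\sqrt{5}}e^{26},\ \frac{r}{\sqrt{5}}e^{36},\ \frac{r}{\sqrt{5}}e^{46},\ \frac{r}{\sqrt{5}}e^{56},\ 0\right)$ $\mathfrak{s}_{10}$ (parameter $t$): $\left(\frac{2r}{\sqrt{33}}e^{15}+rt\,e^{16}+r\sqrt{\frac12-11t^2}\,e^{26},\ \frac{2r}{\sqrt{33}}e^{25}+r\sqrt{\frac12-11t^2}\,e^{16}+rt\,e^{26},\ -r\sqrt{\frac23}e^{12}+\frac{4r}{\sqrt{33}}e^{35}+2rt\,e^{36},\ \frac{3r}{\sqrt{33}}e^{45}-4rt\,e^{46},\ 0,\ 0\right)$ $\mathfrak{s}_{11}$: $\left(\frac{r}{\sqrt{30}}e^{15}+\frac{3r}{\sqrt{30}}e^{16},\ \frac{2r}{\sqrt{30}}e^{25}-\frac{4r}{\sqrt{30}}e^{26},\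 -r\sqrt{\frac23}e^{12}+\frac{3r}{\sqrt{30}}e^{35}-\frac{r}{\sqrt{30}}e^{36},\ -r\sqrt{\frac23}e^{13}+\frac{4r}{\sqrt{30}}e^{45}+\frac{2r}{\sqrt{30}}e^{46},\ 0,\ 0\right)$ $\mathfrak{s}_{12}$ (parameters $s,t$): $\left(\frac{r}{2}e^{15}+r\frac{1+s+t}{2\sqrt{1+t^2+s^2}}e^{16},\ \frac{r}{2}e^{25}+r\frac{1-s-t}{2\sqrt{1+t^2+s^2}}e^{26},\ \frac{r}{2}e^{35}+r\frac{t-s-1}{2\sqrt{1+t^2+s^2}}e^{36},\ \frac{r}{2}e^{45}+r\frac{s-t-1}{2\sqrt{1+t^2+s^2}}e^{46},\ 0,\ 0\right)$ $\mathfrak{s}_{13}$: $\left(\frac{r}{\sqrt{3}}e^{14}-\frac{2r}{\sqrt{6}}e^{16},\ \frac{r}{\sqrt{3}}e^{24}+\frac{r}{\sqrt{2}}e^{25}+\frac{r}{\sqrt{6}}e^{26},\ \frac{r}{\sqrt{3}}e^{34}-\frac{r}{\sqrt{2}}e^{35}+\frac{r}{\sqrt{6}}e^{36},\ 0,\ 0,\ 0\right)$ *)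

theory Defs
  imports "HOL-Analysis.Analysis"
begin

section \<open>Exterior algebra of a 6-dimensional real vector space\<close>

text \<open>A covariant tensor of degree \<open>k\<close> is a function on lists of vectors that is
  multilinear on lists of length \<open>k\<close> and zero on all other lists. Hence equality of tensors is
  equality of functions, and the exterior product needs no degree arguments.\<close>

type_synonym covariant = "(real^6) list \<Rightarrow> real"

definition multilinear :: "nat \<Rightarrow> covariant \<Rightarrow> bool" where
  "multilinear k \<alpha> \<longleftrightarrow> (\<forall>vs. length vs \<noteq> k \<longrightarrow> \<alpha> vs = 0) \<and>
     (\<forall>vs i. length vs = k \<and> i < k \<longrightarrow> linear (\<lambda>v. \<alpha> (vs[i := v])))"

definition alternating :: "nat \<Rightarrow> covariant \<Rightarrow> bool" where
  "alternating k \<alpha> \<longleftrightarrow> multilinear k \<alpha> \<and> (\<forall>vs. \<not> distinct vs \<longrightarrow> \<alpha> vs = 0)"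

text \<open>The shuffle formula, in the determinant convention
  \<open>(\<alpha> \<and> \<beta>)(v, w) = \<alpha>(v) \<beta>(w) - \<alpha>(w) \<beta>(v)\<close> for 1-forms. The set \<open>I\<close> contains the
  positions of the arguments given to \<open>\<alpha>\<close>; only sets whose size is the degree of \<open>\<alpha>\<close> contribute.\<close>

definition wedge :: "covariant \<Rightarrow> covariant \<Rightarrow> covariant" (infixl "\<and>\<^sub>f" 70) where
  "(\<alpha> \<and>\<^sub>f \<beta>) vs = (\<Sum>I\<in>Pow {..<length vs}.
     (-1) ^ card {(i, j). i \<in> I \<and> j \<in> {..<length vs} - I \<and> j < i} *
     \<alpha> (nths vs I) * \<beta> (nths vs ({..<length vs} - I)))"

definition interior_product :: "real^6 \<Rightarrow> covariant \<Rightarrow> covariant" where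
  "interior_product v \<alpha> = (\<lambda>vs. \<alpha> (v # vs))"

definition pullback_linear :: "(real^6 \<Rightarrow> real^6) \<Rightarrow> covariant \<Rightarrow> covariant" where
  "pullback_linear f \<alpha> = (\<lambda>vs. \<alpha> (map f vs))"


section \<open>Stable forms and linear SU(3)-structures\<close>

text \<open>A nonzero 6-form \<open>\<Omega>\<close> identifies \<open>V \<otimes> \<Lambda>\<^sup>6 V*\<close> with \<open>V\<close> and the square of
  \<open>\<Lambda>\<^sup>6 V*\<close> with the reals: Hitchin's map
  \<open>K\<^sub>\<rho> v = A((i\<^sub>v \<rho>) \<and> \<rho>)\<close> is \<open>v \<mapsto> hitchin_K \<Omega> \<rho> v \<otimes> \<Omega>\<close>, and his invariant
  \<open>\<lambda>(\<rho>) = tr(K\<^sub>\<rho>\<^sup>2) / 6\<close> is \<open>hitchin_lambda \<Omega> \<rho>\<close> times the square of \<open>\<Omega>\<close>. The sign of \<open>hitchin_lambda\<close> is independent of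
  \<open>\<Omega>\<close>. When \<open>\<Omega>\<close> is positive, the positive square root of \<open>|\<lambda>(\<rho>)|\<close> is
  \<open>sqrt |hitchin_lambda \<Omega> \<rho>|\<close> times \<open>\<Omega>\<close>, so \<open>hitchin_J\<close> depends only on the orientation
  given by \<open>\<Omega>\<close>.\<close>

definition hitchin_K :: "covariant \<Rightarrow> covariant \<Rightarrow> real^6 \<Rightarrow> real^6" where
  "hitchin_K \<Omega> \<rho> v = (THE w. interior_product w \<Omega> = interior_product v \<rho> \<and>\<^sub>f \<rho>)"

definition hitchin_lambda :: "covariant \<Rightarrow> covariant \<Rightarrow> real" where
  "hitchin_lambda \<Omega> \<rho> = trace (matrix (hitchin_K \<Omega> \<rho> \<circ> hitchin_K \<Omega> \<rho>)) / 6"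

definition hitchin_J :: "covariant \<Rightarrow> covariant \<Rightarrow> real^6 \<Rightarrow> real^6" where
  "hitchin_J \<Omega> \<rho> v = - (1 / sqrt \<bar>hitchin_lambda \<Omega> \<rho>\<bar>) *\<^sub>R hitchin_K \<Omega> \<rho> v"

definition cube :: "covariant \<Rightarrow> covariant" where
  "cube \<omega> = \<omega> \<and>\<^sub>f \<omega> \<and>\<^sub>f \<omega>"

definition stable_2form :: "covariant \<Rightarrow> bool" where
  "stable_2form \<omega> \<longleftrightarrow> alternating 2 \<omega> \<and> cube \<omega> \<noteq> (\<lambda>_. 0)"

definition su3_J :: "covariant \<Rightarrow> covariant \<Rightarrow> real^6 \<Rightarrow> real^6" where
  "su3_J \<omega> \<psi> = hitchin_J (cube \<omega>) \<psi>"

definition psi_minus :: "covariant \<Rightarrow> covariant \<Rightarrow> covariant" where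
  "psi_minus \<omega> \<psi> = pullback_linear (su3_J \<omega> \<psi>) \<psi>"

definition su3_metric :: "covariant \<Rightarrow> covariant \<Rightarrow> covariant" where
  "su3_metric \<omega> \<psi> vs = (case vs of [v, w] \<Rightarrow> \<omega> [v, su3_J \<omega> \<psi> w] | _ \<Rightarrow> 0)"

definition inner_product :: "covariant \<Rightarrow> bool" where
  "inner_product g \<longleftrightarrow> multilinear 2 g \<and> (\<forall>v w. g [v, w] = g [w, v]) \<and>
     (\<forall>v. v \<noteq> 0 \<longrightarrow> g [v, v] > 0)"

text \<open>Since \<open>cube \<omega>\<close> is a volume form, stability of the 3-form with negative invariant is the
  single condition \<open>hitchin_lambda (cube \<omega>) \<psi> < 0\<close>.\<close>

definition linear_su3_structure :: "covariant \<Rightarrow> covariant \<Rightarrow> bool" where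
  "linear_su3_structure \<omega> \<psi> \<longleftrightarrow>
     stable_2form \<omega> \<and>
     alternating 3 \<psi> \<and> hitchin_lambda (cube \<omega>) \<psi> < 0 \<and>
     \<omega> \<and>\<^sub>f \<psi> = (\<lambda>_. 0) \<and>
     \<psi> \<and>\<^sub>f psi_minus \<omega> \<psi> = (\<lambda>vs. 2 / 3 * cube \<omega> vs) \<and>
     inner_product (su3_metric \<omega> \<psi>)"


section \<open>Smooth 6-manifolds\<close>

primrec Ck_on :: "nat \<Rightarrow> 'a::real_normed_vector set \<Rightarrow> ('a \<Rightarrow> 'b::real_normed_vector) \<Rightarrow> bool" where
  "Ck_on 0 S f = continuous_on S f"
| "Ck_on (Suc k) S f = ((\<forall>x\<in>S. f differentiable (at x)) \<and>
     (\<forall>v. Ck_on k S (\<lambda>x. frechet_derivative f (at x) v)))"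

text \<open>Only used for open \<open>S\<close>.\<close>

definition smooth_on :: "'a::real_normed_vector set \<Rightarrow> ('a \<Rightarrow> 'b::real_normed_vector) \<Rightarrow> bool" where
  "smooth_on S f \<longleftrightarrow> (\<forall>k. Ck_on k S f)"

text \<open>A smooth manifold is given by an atlas indexed by the points of \<open>M\<close>: to each point \<open>p\<close>
  belongs a chart (domain and coordinate map) around \<open>p\<close>. Every atlas contains one of this shape
  defining the same smooth structure. The chart at \<open>p\<close> identifies the tangent space at \<open>p\<close> with
  \<open>real^6\<close>, so tensor fields and tangent maps take values in fixed spaces.\<close>

type_synonym 'm charts = "'m \<Rightarrow> 'm set \<times> ('m \<Rightarrow> real^6)"

definition chart_dom :: "'m charts \<Rightarrow> 'm \<Rightarrow> 'm set" where
  "chart_dom C p = fst (C p)"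

definition chart :: "'m charts \<Rightarrow> 'm \<Rightarrow> 'm \<Rightarrow> real^6" where
  "chart C p = snd (C p)"

definition chart_inv :: "'m charts \<Rightarrow> 'm \<Rightarrow> real^6 \<Rightarrow> 'm" where
  "chart_inv C p = the_inv_into (chart_dom C p) (chart C p)"

definition chart_image :: "'m charts \<Rightarrow> 'm \<Rightarrow> (real^6) set" where
  "chart_image C p = chart C p ` chart_dom C p"

definition smooth_manifold :: "'m::{t2_space, second_countable_topology} charts \<Rightarrow> bool" where
  "smooth_manifold C \<longleftrightarrow>
     (\<forall>p. p \<in> chart_dom C p \<and> open (chart_dom C p) \<and> open (chart_image C p) \<and>
        homeomorphism (chart_dom C p) (chart_image C p) (chart C p) (chart_inv C p)) \<and>
     (\<forall>p q. smooth_on (chart C p ` (chart_dom C p \<inter> chart_dom C q)) (chart C q \<circ> chart_inv C p))"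

definition smooth_map :: "'m::topological_space charts \<Rightarrow> ('m \<Rightarrow> 'm) \<Rightarrow> bool" where
  "smooth_map C F \<longleftrightarrow> continuous_on UNIV F \<and>
     (\<forall>p. smooth_on (chart C p ` (chart_dom C p \<inter> F -` chart_dom C (F p)))
        (chart C (F p) \<circ> F \<circ> chart_inv C p))"

definition tangent_map :: "'m charts \<Rightarrow> ('m \<Rightarrow> 'm) \<Rightarrow> 'm \<Rightarrow> real^6 \<Rightarrow> real^6" where
  "tangent_map C F p = frechet_derivative (chart C (F p) \<circ> F \<circ> chart_inv C p) (at (chart C p p))"

type_synonym 'm tensor_field = "'m \<Rightarrow> covariant"

definition pullback :: "'m charts \<Rightarrow> ('m \<Rightarrow> 'm) \<Rightarrow> 'm tensor_field \<Rightarrow> 'm tensor_field" where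
  "pullback C F T = (\<lambda>p. pullback_linear (tangent_map C F p) (T (F p)))"

text \<open>The coordinate expression, on \<open>chart_image C p\<close>, of a tensor field in the chart at \<open>p\<close>.
  The value of \<open>T\<close> at the point \<open>q\<close> with coordinates \<open>x\<close> refers to the chart at \<open>q\<close>, hence the
  derivative of the coordinate change.\<close>

definition local_rep :: "'m charts \<Rightarrow> 'm tensor_field \<Rightarrow> 'm \<Rightarrow> real^6 \<Rightarrow> covariant" where
  "local_rep C T p x = (let q = chart_inv C p x in
     pullback_linear (frechet_derivative (chart C q \<circ> chart_inv C p) (at x)) (T q))"

definition smooth_tensor_field :: "'m charts \<Rightarrow> 'm tensor_field \<Rightarrow> bool" where
  "smooth_tensor_field C T \<longleftrightarrow> (\<forall>p vs. smooth_on (chart_image C p) (\<lambda>x. local_rep C T p x vs))"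

definition differential_form :: "'m charts \<Rightarrow> nat \<Rightarrow> 'm tensor_field \<Rightarrow> bool" where
  "differential_form C k \<omega> \<longleftrightarrow> (\<forall>p. alternating k (\<omega> p)) \<and> smooth_tensor_field C \<omega>"

text \<open>On an open subset of \<open>real^6\<close>, evaluated on constant vector fields.\<close>

definition ext_deriv_local :: "(real^6 \<Rightarrow> covariant) \<Rightarrow> real^6 \<Rightarrow> covariant" where
  "ext_deriv_local \<alpha> x vs = (\<Sum>i<length vs.
     (-1) ^ i * frechet_derivative (\<lambda>y. \<alpha> y (take i vs @ drop (Suc i) vs)) (at x) (vs ! i))"

definition ext_deriv :: "'m charts \<Rightarrow> 'm tensor_field \<Rightarrow> 'm tensor_field" where
  "ext_deriv C \<alpha> p = ext_deriv_local (local_rep C \<alpha> p) (chart C p p)"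


section \<open>Riemannian geometry\<close>

definition riemannian_metric :: "'m charts \<Rightarrow> 'm tensor_field \<Rightarrow> bool" where
  "riemannian_metric C h \<longleftrightarrow> (\<forall>p. inner_product (h p)) \<and> smooth_tensor_field C h"

text \<open>For a metric \<open>g\<close> on an open subset of \<open>real^6\<close> and constant vector fields \<open>u\<close>, \<open>v\<close>, \<open>w\<close>:
  \<open>christoffel g x u v\<close> is the Levi-Civita derivative of \<open>v\<close> along \<open>u\<close> (Koszul formula), and
  \<open>riemann_local g x u v w\<close> is \<open>R(u,v)w = \<nabla>\<^sub>u\<nabla>\<^sub>v w - \<nabla>\<^sub>v\<nabla>\<^sub>u w\<close>.\<close>

definition christoffel :: "(real^6 \<Rightarrow> covariant) \<Rightarrow> real^6 \<Rightarrow> real^6 \<Rightarrow> real^6 \<Rightarrow> real^6" where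
  "christoffel g x u v = (THE w. \<forall>z. g x [w, z] =
     (frechet_derivative (\<lambda>y. g y [v, z]) (at x) u
      + frechet_derivative (\<lambda>y. g y [u, z]) (at x) v
      - frechet_derivative (\<lambda>y. g y [u, v]) (at x) z) / 2)"

definition riemann_local ::
  "(real^6 \<Rightarrow> covariant) \<Rightarrow> real^6 \<Rightarrow> real^6 \<Rightarrow> real^6 \<Rightarrow> real^6 \<Rightarrow> real^6" where
  "riemann_local g x u v w =
     frechet_derivative (\<lambda>y. christoffel g y v w) (at x) u
     - frechet_derivative (\<lambda>y. christoffel g y u w) (at x) v
     + christoffel g x u (christoffel g x v w)
     - christoffel g x v (christoffel g x u w)"

definition riemann ::
  "'m charts \<Rightarrow> 'm tensor_field \<Rightarrow> 'm \<Rightarrow> real^6 \<Rightarrow> real^6 \<Rightarrow> real^6 \<Rightarrow> real^6" where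
  "riemann C h p = riemann_local (local_rep C h p) (chart C p p)"

definition flat :: "'m charts \<Rightarrow> 'm tensor_field \<Rightarrow> bool" where
  "flat C h \<longleftrightarrow> (\<forall>p u v w. riemann C h p u v w = 0)"

definition ricci :: "'m charts \<Rightarrow> 'm tensor_field \<Rightarrow> 'm \<Rightarrow> real^6 \<Rightarrow> real^6 \<Rightarrow> real" where
  "ricci C h p v w = trace (matrix (\<lambda>u. riemann C h p u v w))"

definition einstein :: "'m charts \<Rightarrow> 'm tensor_field \<Rightarrow> bool" where
  "einstein C h \<longleftrightarrow> (\<exists>c. \<forall>p v w. ricci C h p v w = c * h p [v, w])"

definition sectional_curvature ::
  "'m charts \<Rightarrow> 'm tensor_field \<Rightarrow> 'm \<Rightarrow> real^6 \<Rightarrow> real^6 \<Rightarrow> real" where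
  "sectional_curvature C h p u v =
     h p [riemann C h p u v v, u] / (h p [u, u] * h p [v, v] - (h p [u, v])\<^sup>2)"

definition nonpositive_curvature :: "'m charts \<Rightarrow> 'm tensor_field \<Rightarrow> bool" where
  "nonpositive_curvature C h \<longleftrightarrow>
     (\<forall>p u v. u \<noteq> v \<and> independent {u, v} \<longrightarrow> sectional_curvature C h p u v \<le> 0)"

definition isometry :: "'m::topological_space charts \<Rightarrow> 'm tensor_field \<Rightarrow> ('m \<Rightarrow> 'm) \<Rightarrow> bool" where
  "isometry C h F \<longleftrightarrow> bij F \<and> smooth_map C F \<and> smooth_map C (inv F) \<and> pullback C F h = h"

definition homogeneous :: "'m::topological_space charts \<Rightarrow> 'm tensor_field \<Rightarrow> bool" where
  "homogeneous C h \<longleftrightarrow> (\<forall>p q. \<exists>F. isometry C h F \<and> F p = q)"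


section \<open>Lie groups and solvmanifolds\<close>

definition lie_group ::
  "'m::topological_space charts \<Rightarrow> ('m \<Rightarrow> 'm \<Rightarrow> 'm) \<Rightarrow> 'm \<Rightarrow> ('m \<Rightarrow> 'm) \<Rightarrow> bool" where
  "lie_group C mul unit iv \<longleftrightarrow>
     group mul unit iv \<and>
     continuous_on UNIV (\<lambda>(p, q). mul p q) \<and>
     (\<forall>p q. smooth_on
        {(x, y). x \<in> chart_image C p \<and> y \<in> chart_image C q \<and>
           mul (chart_inv C p x) (chart_inv C q y) \<in> chart_dom C (mul p q)}
        (\<lambda>(x, y). chart C (mul p q) (mul (chart_inv C p x) (chart_inv C q y)))) \<and>
     smooth_map C iv"

definition left_invariant ::
  "'m charts \<Rightarrow> ('m \<Rightarrow> 'm \<Rightarrow> 'm) \<Rightarrow> 'm tensor_field \<Rightarrow> bool" where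
  "left_invariant C mul T \<longleftrightarrow> (\<forall>a. pullback C (mul a) T = T)"

text \<open>Structure equations: the \<open>i\<close>-th entry of the list contains the triples \<open>(c, j, k)\<close>
  standing for the summands \<open>c e\<^sup>j\<^sup>k\<close> of \<open>de\<^sup>i\<close>. Indices run from 1 to 6, list positions from 0.\<close>

type_synonym structure_equations = "(real \<times> nat \<times> nat) list list"

text \<open>\<open>(M, h)\<close> with the given multiplication is a Lie group with left invariant metric, whose
  metric Lie algebra has an orthonormal basis with the given structure equations. The dual basis is
  represented by the left invariant 1-forms \<open>e i\<close>, on which the exterior derivative is the
  Chevalley-Eilenberg differential.\<close>

definition metric_lie_group_with ::
  "'m::topological_space charts \<Rightarrow> 'm tensor_field \<Rightarrow> ('m \<Rightarrow> 'm \<Rightarrow> 'm) \<Rightarrow> 'm \<Rightarrow> ('m \<Rightarrow> 'm) \<Rightarrow>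
     structure_equations \<Rightarrow> bool" where
  "metric_lie_group_with C h mul unit iv S \<longleftrightarrow>
     lie_group C mul unit iv \<and> left_invariant C mul h \<and>
     (\<exists>e :: nat \<Rightarrow> 'm tensor_field.
        (\<forall>i\<in>{1..6}. differential_form C 1 (e i) \<and> left_invariant C mul (e i)) \<and>
        (\<forall>p v w. h p [v, w] = (\<Sum>i=1..6. e i p [v] * e i p [w])) \<and>
        (\<forall>i\<in>{1..6}. \<forall>p. ext_deriv C (e i) p =
           (\<lambda>vs. \<Sum>(c, j, k)\<leftarrow>S ! (i - 1). c * (e j p \<and>\<^sub>f e k p) vs)))"

definition \<ss>1 :: "real \<Rightarrow> structure_equations" where
  "\<ss>1 r =
    [[(r / (2 * sqrt 2), 1, 6)],
     [(r / (2 * sqrt 2), 2, 6)],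
     [(r / (2 * sqrt 2), 3, 6)],
     [(r / (2 * sqrt 2), 4, 6)],
     [(- r / sqrt 2, 1, 2), (- r / sqrt 2, 3, 4), (r / sqrt 2, 5, 6)],
     []]"

definition \<ss>5 :: "real \<Rightarrow> structure_equations" where
  "\<ss>5 r =
    [[(r / (3 * sqrt 2), 1, 6)],
     [(r / (2 * sqrt 2), 2, 6)],
     [(r / (2 * sqrt 2), 3, 6)],
     [(- r / sqrt 2, 1, 2), (5 * r / (6 * sqrt 2), 4, 6)],
     [(- r / sqrt 2, 1, 3), (5 * r / (6 * sqrt 2), 5, 6)],
     []]"

definition \<ss>8 :: "real \<Rightarrow> structure_equations" where
  "\<ss>8 r =
    [[(r * sqrt (2 / 21), 1, 6)],
     [(r * sqrt (2 / 21), 2, 6)],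
     [(- r * sqrt (2 / 3), 1, 2), (2 * r * sqrt (2 / 21), 3, 6)],
     [(r * sqrt (3 / 14), 4, 6)],
     [(r * sqrt (3 / 14), 5, 6)],
     []]"

definition \<ss>9 :: "real \<Rightarrow> structure_equations" where
  "\<ss>9 r =
    [[(r / sqrt 5, 1, 6)],
     [(r / sqrt 5, 2, 6)],
     [(r / sqrt 5, 3, 6)],
     [(r / sqrt 5, 4, 6)],
     [(r / sqrt 5, 5, 6)],
     []]"

definition \<ss>10 :: "real \<Rightarrow> real \<Rightarrow> structure_equations" where
  "\<ss>10 r t =
    [[(2 * r / sqrt 33, 1, 5), (r * t, 1, 6), (r * sqrt (1 / 2 - 11 * t\<^sup>2), 2, 6)],
     [(2 * r / sqrt 33, 2, 5), (r * sqrt (1 / 2 - 11 * t\<^sup>2), 1, 6), (r * t, 2, 6)],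
     [(- r * sqrt (2 / 3), 1, 2), (4 * r / sqrt 33, 3, 5), (2 * r * t, 3, 6)],
     [(3 * r / sqrt 33, 4, 5), (- 4 * r * t, 4, 6)],
     [],
     []]"

definition \<ss>11 :: "real \<Rightarrow> structure_equations" where
  "\<ss>11 r =
    [[(r / sqrt 30, 1, 5), (3 * r / sqrt 30, 1, 6)],
     [(2 * r / sqrt 30, 2, 5), (- 4 * r / sqrt 30, 2, 6)],
     [(- r * sqrt (2 / 3), 1, 2), (3 * r / sqrt 30, 3, 5), (- r / sqrt 30, 3, 6)],
     [(- r * sqrt (2 / 3), 1, 3), (4 * r / sqrt 30, 4, 5), (2 * r / sqrt 30, 4, 6)],
     [],
     []]"

definition \<ss>12 :: "real \<Rightarrow> real \<Rightarrow> real \<Rightarrow> structure_equations" where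
  "\<ss>12 r s t =
    [[(r / 2, 1, 5), (r * ((1 + s + t) / (2 * sqrt (1 + t\<^sup>2 + s\<^sup>2))), 1, 6)],
     [(r / 2, 2, 5), (r * ((1 - s - t) / (2 * sqrt (1 + t\<^sup>2 + s\<^sup>2))), 2, 6)],
     [(r / 2, 3, 5), (r * ((t - s - 1) / (2 * sqrt (1 + t\<^sup>2 + s\<^sup>2))), 3, 6)],
     [(r / 2, 4, 5), (r * ((s - t - 1) / (2 * sqrt (1 + t\<^sup>2 + s\<^sup>2))), 4, 6)],
     [],
     []]"

definition \<ss>13 :: "real \<Rightarrow> structure_equations" where
  "\<ss>13 r =
    [[(r / sqrt 3, 1, 4), (- 2 * r / sqrt 6, 1, 6)],
     [(r / sqrt 3, 2, 4), (r / sqrt 2, 2, 5), (r / sqrt 6, 2, 6)],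
     [(r / sqrt 3, 3, 4), (- r / sqrt 2, 3, 5), (r / sqrt 6, 3, 6)],
     [],
     [],
     []]"

text \<open>The algebras through which the Nikitenko-Nikonorov theorem identifies 6-dimensional,
  connected, simply connected, homogeneous, non-flat Einstein manifolds of nonpositive sectional
  curvature with solvmanifolds. All of them are solvable.\<close>

definition nikitenko_nikonorov :: "real \<Rightarrow> structure_equations set" where
  "nikitenko_nikonorov r =
     {\<ss>5 r, \<ss>8 r, \<ss>1 r, \<ss>9 r, \<ss>10 r (1 / sqrt 22), \<ss>11 r, \<ss>12 r 0 0, \<ss>12 r 1 1, \<ss>13 r}"


section \<open>SU(3)-structures on manifolds\<close>

definition induced_metric :: "'m tensor_field \<Rightarrow> 'm tensor_field \<Rightarrow> 'm tensor_field" where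
  "induced_metric \<omega> \<psi> = (\<lambda>p. su3_metric (\<omega> p) (\<psi> p))"

definition su3_structure :: "'m charts \<Rightarrow> 'm tensor_field \<Rightarrow> 'm tensor_field \<Rightarrow> bool" where
  "su3_structure C \<omega> \<psi> \<longleftrightarrow>
     differential_form C 2 \<omega> \<and> differential_form C 3 \<psi> \<and>
     (\<forall>p. linear_su3_structure (\<omega> p) (\<psi> p)) \<and>
     riemannian_metric C (induced_metric \<omega> \<psi>)"

definition half_flat :: "'m charts \<Rightarrow> 'm tensor_field \<Rightarrow> 'm tensor_field \<Rightarrow> bool" where
  "half_flat C \<omega> \<psi> \<longleftrightarrow> su3_structure C \<omega> \<psi> \<and>
     (\<forall>p. ext_deriv C \<psi> p = (\<lambda>_. 0)) \<and>
     (\<forall>p. ext_deriv C (\<lambda>q. \<omega> q \<and>\<^sub>f \<omega> q) p = (\<lambda>_. 0))"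

definition coupled :: "'m charts \<Rightarrow> 'm tensor_field \<Rightarrow> 'm tensor_field \<Rightarrow> bool" where
  "coupled C \<omega> \<psi> \<longleftrightarrow> half_flat C \<omega> \<psi> \<and>
     (\<exists>c :: 'm \<Rightarrow> real. (\<forall>p. c p \<noteq> 0) \<and> (\<forall>p. ext_deriv C \<omega> p = (\<lambda>vs. c p * \<psi> p vs)))"

end

theory Submission
  imports Defs
begin

text \<open>
  All the metric Lie algebras in question split orthogonally as \<open>\<nn> \<oplus> \<aa>\<close>, where the ideal \<open>\<nn>\<close>
  contains the derived algebra and \<open>\<aa>\<close> is abelian and acts on \<open>\<nn>\<close> diagonally in the given
  orthonormal frame \<open>E\<^sub>1, \<dots>, E\<^sub>6\<close>; let \<open>\<alpha>\<^sub>k\<close> be the root of \<open>E\<^sub>k\<close>, regarded as a vector of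
  \<open>\<aa>\<close>. The centre of \<open>\<nn>\<close> contains a frame vector \<open>v = E\<^sub>m\<close> whose root \<open>\<alpha> = \<alpha>\<^sub>m\<close> is nonzero
  and makes no obtuse angle with any other root. This alone excludes coupled structures.

  The tool is a fact of linear algebra: in a linear SU(3)-structure the kernel of the 2-form
  \<open>\<psi>(u, \<cdot>, \<cdot>)\<close> is spanned by \<open>u\<close> and \<open>J u\<close>, for every \<open>u \<noteq> 0\<close> (lemmas
  \<open>su3_J_in_kernel\<close> and \<open>su3_kernel\<close>). For a coupled structure \<open>d\<omega>\<close> is a nonzero multiple of
  \<open>\<psi>\<close>, so \<open>d\<omega>(u, \<cdot>, \<cdot>)\<close> has the same kernel.

  Let \<open>z\<close> be the vector with \<open>J z = v\<close>, that is, \<open>h(\<cdot>, z) = \<omega>(\<cdot>, v)\<close>. Then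
  \<open>d\<omega>(z, v, \<alpha>) = 0\<close>. By the structure equations this number is, with \<open>z\<^sub>\<aa>\<close> the component of
  \<open>z\<close> in \<open>\<aa>\<close> and \<open>k\<close> running over the indices of \<open>\<nn>\<close>, the negative of
  \<open>|\<alpha>|\<^sup>2 |z|\<^sup>2 + (\<Sum>k. \<langle>\<alpha>, \<alpha>\<^sub>k\<rangle> z\<^sub>k\<^sup>2) - \<langle>\<alpha>, z\<^sub>\<aa>\<rangle>\<^sup>2\<close>, and Cauchy-Schwarz bounds the latter from
  below by \<open>\<Sum>k. (|\<alpha>|\<^sup>2 + \<langle>\<alpha>, \<alpha>\<^sub>k\<rangle>) z\<^sub>k\<^sup>2\<close>, whose coefficients are positive. Hence \<open>z\<close> lies in
  \<open>\<aa>\<close>, which says that \<open>\<omega>(v, \<cdot>)\<close> vanishes on \<open>\<nn>\<close>. As \<open>v\<close> is a central root vector, now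
  \<open>d\<omega>(v, x, \<cdot>) = 0\<close> for all \<open>x\<close> in \<open>\<nn>\<close>. So \<open>\<nn>\<close> lies in the span of \<open>v\<close> and \<open>J v\<close>, and
  because \<open>\<omega>(v, J v) = h(v, v) > 0\<close> it is even contained in the line of \<open>v\<close>, although
  its dimension is at least 3 (lemma \<open>no_coupled_of_dominant_central_root\<close>).

  The passage from the manifold to the Lie algebra uses that a left invariant 2-form has constant
  coefficients in the left invariant coframe, so that the Leibniz rule expresses \<open>d\<omega>\<close> through the
  structure equations (lemmas \<open>left_invariant_frame_coefficient\<close> and
  \<open>ext_deriv_frame_2form\<close>); everything then takes place in one tangent space.
\<close>


section \<open>Interior and exterior products\<close>

lemma wedge_Nil: "(\<alpha> \<and>\<^sub>f \<beta>) [] = \<alpha> [] * \<beta> []"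
  by (simp add: wedge_def)

text \<open>The interior product is an antiderivation. Among the shuffles of the list \<open>v # vs\<close>, those giving
  \<open>v\<close> to \<open>\<alpha>\<close> form the first summand; in the others \<open>v\<close> passes all \<open>k\<close> arguments of \<open>\<alpha>\<close>. The rule
  turns the shuffle formula into a recursion on the argument list, which replaces any further
  calculation with subsets and signs.\<close>

lemma interior_product_wedge:
  assumes deg: "\<And>vs. length vs \<noteq> k \<Longrightarrow> \<alpha> vs = 0"
  shows "(\<alpha> \<and>\<^sub>f \<beta>) (v # vs) =
    (interior_product v \<alpha> \<and>\<^sub>f \<beta>) vs + (-1) ^ k * (\<alpha> \<and>\<^sub>f interior_product v \<beta>) vs"
proof -
  define n where "n = length vs"
  define invs where "invs = (\<lambda>I n. {(i::nat, j::nat). i \<in> I \<and> j \<in> {..<n::nat} - I \<and> j < i})"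
  define tm where "tm = (\<lambda>I. (-1) ^ card (invs I (Suc n)) * \<alpha> (nths (v # vs) I) * \<beta> (nths (v # vs) ({..<Suc n} - I)))"
  \<comment> \<open>The subsets of the positions are split according to whether they contain the position 0 of \<open>v\<close>.\<close>
  have zero: "I \<in> (`) Suc ` Pow {..<n} \<or> I \<in> (\<lambda>I. insert 0 (Suc ` I)) ` Pow {..<n}"
    if I: "I \<subseteq> {..<Suc n}" for I
  proof -
    define I' where "I' = {i. Suc i \<in> I}"
    have "I' \<in> Pow {..<n}" using I by (auto simp: I'_def)
    moreover have "I = (if 0 \<in> I then insert 0 (Suc ` I') else Suc ` I')"
    proof -
      have "x \<in> I \<longleftrightarrow> x \<in> (if 0 \<in> I then insert 0 (Suc ` I') else Suc ` I')" for x
        by (cases x) (auto simp: I'_def)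
      then show ?thesis by blast
    qed
    ultimately show ?thesis by (metis (mono_tags, lifting) image_eqI)
  qed
  have Pow_Suc: "Pow {..<Suc n} = (\<lambda>I. insert 0 (Suc ` I)) ` Pow {..<n} \<union> (`) Suc ` Pow {..<n}"
  proof (intro equalityI subsetI)
    show "I \<in> (\<lambda>I. insert 0 (Suc ` I)) ` Pow {..<n} \<union> (`) Suc ` Pow {..<n}" if "I \<in> Pow {..<Suc n}" for I
      using zero[of I] that by blast
  qed auto
  have inj0: "inj_on (\<lambda>I. insert 0 (Suc ` I)) (Pow {..<n})"
    by (rule inj_onI) (metis image_iff insert_ident inj_Suc inj_image_eq_iff nat.distinct(1))
  have injS: "inj_on ((`) Suc) (Pow {..<n})"
    by (rule inj_onI) (simp add: inj_image_eq_iff)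
  have disj: "(\<lambda>I. insert 0 (Suc ` I)) ` Pow {..<n} \<inter> (`) Suc ` Pow {..<n} = {}"
    by (auto simp: set_eq_iff)
  have fin: "finite (invs I m)" if "finite I" for I m
    by (rule finite_subset[of _ "I \<times> {..<m}"]) (use that in \<open>auto simp: invs_def\<close>)
  have with0: "tm (insert 0 (Suc ` I)) = (-1) ^ card (invs I n) *
      interior_product v \<alpha> (nths vs I) * \<beta> (nths vs ({..<n} - I))" if "I \<subseteq> {..<n}" for I
  proof -
    have "invs (insert 0 (Suc ` I)) (Suc n) = map_prod Suc Suc ` invs I n"
      by (force simp: invs_def image_iff less_Suc_eq_0_disj gr0_conv_Suc)
    then have "card (invs (insert 0 (Suc ` I)) (Suc n)) = card (invs I n)"
      by (simp add: card_image prod.inj_map inj_on_subset[OF prod.inj_map[OF inj_Suc inj_Suc]])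
    moreover have "{j. Suc j \<in> {..<Suc n} - insert 0 (Suc ` I)} = {..<n} - I" by auto
    ultimately show ?thesis
      by (simp add: tm_def nths_Cons interior_product_def image_iff)
  qed
  have without0: "tm (Suc ` I) = (-1) ^ k * ((-1) ^ card (invs I n) *
      \<alpha> (nths vs I) * interior_product v \<beta> (nths vs ({..<n} - I)))" if I: "I \<subseteq> {..<n}" for I
  proof (cases "card I = k")
    case True
    have "invs (Suc ` I) (Suc n) = map_prod Suc Suc ` invs I n \<union> Suc ` I \<times> {0}"
      by (force simp: invs_def image_iff less_Suc_eq_0_disj gr0_conv_Suc)
    moreover have "map_prod Suc Suc ` invs I n \<inter> Suc ` I \<times> {0} = {}" by auto
    moreover have "finite I" using I finite_subset by auto
    ultimately have "card (invs (Suc ` I) (Suc n)) = card (invs I n) + card I"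
      by (simp add: card_Un_disjoint fin card_image card_cartesian_product
           inj_on_subset[OF prod.inj_map[OF inj_Suc inj_Suc]])
    moreover have "{j. Suc j \<in> {..<Suc n} - Suc ` I} = {..<n} - I" by auto
    moreover have "{j. Suc j \<in> Suc ` I} = I" by auto
    ultimately show ?thesis using True
      by (simp add: tm_def nths_Cons interior_product_def image_iff power_add)
  next
    case False
    have "length (nths vs I) = card I"
      unfolding length_nths by (rule arg_cong[where f = card]) (use I n_def in auto)
    then have "\<alpha> (nths vs I) = 0" using deg False by simp
    moreover have "{j. Suc j \<in> Suc ` I} = I" by auto
    ultimately show ?thesis by (simp add: tm_def nths_Cons image_iff)
  qed
  have "(\<alpha> \<and>\<^sub>f \<beta>) (v # vs) = sum tm (Pow {..<Suc n})"
    by (simp add: wedge_def tm_def invs_def n_def)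
  also have "\<dots> = (\<Sum>I\<in>Pow {..<n}. tm (insert 0 (Suc ` I))) + (\<Sum>I\<in>Pow {..<n}. tm (Suc ` I))"
    unfolding Pow_Suc
    by (subst sum.union_disjoint) (use disj in \<open>auto simp: sum.reindex[OF inj0] sum.reindex[OF injS]\<close>)
  finally show ?thesis
    by (simp add: with0 without0 wedge_def sum_distrib_left invs_def n_def)
qed

lemma alternating_degree: "alternating k \<alpha> \<Longrightarrow> length vs \<noteq> k \<Longrightarrow> \<alpha> vs = 0"
  by (auto simp: alternating_def multilinear_def)

lemma multilinear_Suc_iff:
  "multilinear (Suc k) \<alpha> \<longleftrightarrow> \<alpha> [] = 0 \<and> (\<forall>v. multilinear k (interior_product v \<alpha>)) \<and>
     (\<forall>vs. length vs = k \<longrightarrow> linear (\<lambda>v. \<alpha> (v # vs)))" (is "?L \<longleftrightarrow> ?R")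
proof
  assume L: ?L
  have "linear (\<lambda>v. \<alpha> (v # vs))" if "length vs = k" for vs
  proof -
    have "linear (\<lambda>v. \<alpha> ((0 # vs)[0 := v]))"
      using L that unfolding multilinear_def by (metis length_Cons zero_less_Suc)
    then show ?thesis by simp
  qed
  moreover have "linear (\<lambda>v. \<alpha> (u # vs[i := v]))" if "length vs = k" "i < k" for u vs i
  proof -
    have "linear (\<lambda>v. \<alpha> ((u # vs)[Suc i := v]))"
      using L that unfolding multilinear_def by (metis Suc_less_eq length_Cons)
    then show ?thesis by simp
  qed
  ultimately show ?R using L by (auto simp: multilinear_def interior_product_def)
next
  assume R: ?R
  have "\<alpha> vs = 0" if "length vs \<noteq> Suc k" for vs
    using R that by (cases vs) (auto simp: multilinear_def interior_product_def)
  moreover have "linear (\<lambda>v. \<alpha> (vs[i := v]))" if "length vs = Suc k" "i < Suc k" for vs i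
    using R that by (cases vs; cases i) (auto simp: multilinear_def interior_product_def)
  ultimately show ?L by (auto simp: multilinear_def)
qed

lemma alternating_interior_product:
  "alternating (Suc k) \<alpha> \<Longrightarrow> alternating k (interior_product v \<alpha>)"
  by (auto simp: alternating_def multilinear_Suc_iff) (auto simp: interior_product_def)

lemma alternating_linear:
  "alternating k \<alpha> \<Longrightarrow> linear (\<lambda>v. \<alpha> (v # vs))"
proof (cases "k = Suc (length vs)")
  case False
  assume "alternating k \<alpha>"
  then have "\<alpha> (v # vs) = 0" for v using False by (auto intro: alternating_degree)
  then show ?thesis by (simp add: linear_iff)
qed (auto simp: alternating_def multilinear_Suc_iff)

text \<open>Polarization of \<open>\<alpha>(v, v, \<dots>) = 0\<close>. Multilinearity in two arguments is all that is assumed, since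
  the criterion for being alternating below depends on this lemma.\<close>

lemma swap_of_interior_product_twice:
  fixes \<alpha> :: covariant
  assumes "\<And>v. \<alpha> (v # v # vs) = 0" "\<And>v. linear (\<lambda>w. \<alpha> (v # w # vs))" "\<And>v. linear (\<lambda>w. \<alpha> (w # v # vs))"
  shows "\<alpha> (v # w # vs) = - \<alpha> (w # v # vs)"
proof -
  have "0 = \<alpha> ((v + w) # (v + w) # vs)" by (simp add: assms(1))
  also have "\<dots> = \<alpha> (v # (v + w) # vs) + \<alpha> (w # (v + w) # vs)" by (rule linear_add[OF assms(3)])
  also have "\<dots> = \<alpha> (v # w # vs) + \<alpha> (w # v # vs)"
    by (simp add: linear_add[OF assms(2)] assms(1))
  finally show ?thesis by linarith
qed

lemma alternating_swap:
  assumes "alternating k \<alpha>"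
  shows "\<alpha> (v # w # vs) = - \<alpha> (w # v # vs)"
proof (rule swap_of_interior_product_twice)
  fix v
  show "\<alpha> (v # v # vs) = 0" using assms by (auto simp: alternating_def)
  show "linear (\<lambda>w. \<alpha> (w # v # vs))" by (rule alternating_linear[OF assms])
  show "linear (\<lambda>w. \<alpha> (v # w # vs))"
  proof (cases k)
    case 0
    then show ?thesis using alternating_degree[OF assms] by (simp add: linear_iff)
  next
    case (Suc n)
    then show ?thesis
      using alternating_linear[OF alternating_interior_product[of n \<alpha> v]] assms
      by (simp add: interior_product_def)
  qed
qed

text \<open>For a form whose contractions are alternating, only a repetition that involves the first argument
  needs an argument. If the repeated vector comes second, this is the last hypothesis; otherwise
  exchanging the first two arguments moves the repetition into a contraction.\<close>

lemma alternating_SucI: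
  assumes nil: "\<alpha> [] = 0"
    and alt: "\<And>v. alternating k (interior_product v \<alpha>)"
    and lin: "\<And>vs. linear (\<lambda>v. \<alpha> (v # vs))"
    and twice: "\<And>v vs. \<alpha> (v # v # vs) = 0"
  shows "alternating (Suc k) \<alpha>"
proof -
  have alt0: "\<alpha> (v # vs) = 0" if "\<not> distinct vs" for v vs
    using alt[of v] that by (auto simp: alternating_def interior_product_def)
  have swap: "\<alpha> (v # w # vs) = - \<alpha> (w # v # vs)" for v w vs
  proof (rule swap_of_interior_product_twice)
    show "linear (\<lambda>w. \<alpha> (v # w # vs))" for v
      using alternating_linear[OF alt[of v]] by (simp add: interior_product_def)
  qed (simp_all add: lin twice)
  have "\<alpha> vs = 0" if "\<not> distinct vs" for vs
  proof -
    from that have "vs \<noteq> []" by auto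
    then obtain v us where vs: "vs = v # us" by (cases vs) auto
    show ?thesis
    proof (cases "v \<in> set us \<and> distinct us")
      case True
      then have "us \<noteq> []" by auto
      then obtain w ws where us: "us = w # ws" by (cases us) auto
      show ?thesis
        using True alt0[of "v # ws" w] twice[of v ws] swap[of v w ws] unfolding vs us by auto
    qed (use that alt0 vs in auto)
  qed
  then show ?thesis
    using nil alt lin by (auto simp: alternating_def multilinear_Suc_iff)
qed

lemma wedge_zero_left: "(\<lambda>_. 0) \<and>\<^sub>f \<beta> = (\<lambda>_. 0)" by (simp add: wedge_def fun_eq_iff)
lemma wedge_zero_right: "\<alpha> \<and>\<^sub>f (\<lambda>_. 0) = (\<lambda>_. 0)" by (simp add: wedge_def fun_eq_iff)

lemma interior_product_alternating_0: "alternating 0 \<alpha> \<Longrightarrow> interior_product v \<alpha> = (\<lambda>_. 0)"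
  by (auto simp: interior_product_def alternating_def multilinear_def)

lemma interior_product_twice:
  "alternating k \<alpha> \<Longrightarrow> interior_product v (interior_product v \<alpha>) = (\<lambda>_. 0)"
  by (auto simp: interior_product_def alternating_def)

lemma linear_wedge_left:
  "(\<And>vs. linear (\<lambda>v. \<alpha> v vs)) \<Longrightarrow> linear (\<lambda>v. (\<alpha> v \<and>\<^sub>f \<beta>) vs)"
  unfolding linear_iff wedge_def
  by (simp add: algebra_simps sum.distrib sum_distrib_left)

lemma linear_wedge_right:
  "(\<And>vs. linear (\<lambda>v. \<beta> v vs)) \<Longrightarrow> linear (\<lambda>v. (\<alpha> \<and>\<^sub>f \<beta> v) vs)"
  unfolding linear_iff wedge_def
  by (simp add: algebra_simps sum.distrib sum_distrib_left)

lemma alternating_linear_combination: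
  assumes "alternating k \<alpha>" "alternating k \<beta>"
  shows "alternating k (\<lambda>vs. a * \<alpha> vs + b * \<beta> vs)"
  using assms unfolding alternating_def multilinear_def linear_iff
  by (auto simp: algebra_simps)

lemma alternating_zero: "alternating k (\<lambda>_. 0)"
  by (simp add: alternating_def multilinear_def linear_iff)

text \<open>Induction on the degree by the criterion above. Contracting twice with the same \<open>v\<close> gives the mixed
  terms \<open>i\<^sub>v \<alpha> \<and> i\<^sub>v \<beta>\<close> twice, with opposite signs. Degree 0 needs cases of its own, since there the
  contraction vanishes.\<close>

lemma alternating_wedge:
  "alternating k \<alpha> \<Longrightarrow> alternating l \<beta> \<Longrightarrow> alternating (k + l) (\<alpha> \<and>\<^sub>f \<beta>)"
proof (induction "k + l" arbitrary: k l \<alpha> \<beta>)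
  case 0
  then have "alternating 0 \<alpha>" "alternating 0 \<beta>" by auto
  then have "(\<alpha> \<and>\<^sub>f \<beta>) (v # vs) = 0" for v vs
    by (subst interior_product_wedge[where k = 0])
      (simp_all add: interior_product_alternating_0 wedge_zero_left wedge_zero_right
        alternating_degree[of 0])
  then have "(\<alpha> \<and>\<^sub>f \<beta>) vs = 0" if "vs \<noteq> []" for vs
    using that by (cases vs) auto
  moreover have "vs \<noteq> []" if "\<not> distinct vs" for vs :: "(real^6) list"
    using that by auto
  ultimately show ?case using 0(1) by (simp add: alternating_def multilinear_def linear_iff)
next
  case (Suc n)
  have left: "alternating n (interior_product v \<alpha> \<and>\<^sub>f \<beta>)" for v
  proof (cases k)
    case 0
    then show ?thesis using Suc.prems
      by (simp add: interior_product_alternating_0 wedge_zero_left alternating_zero)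
  next
    case (Suc k')
    then show ?thesis
      using Suc.hyps(1)[of k' l "interior_product v \<alpha>" \<beta>] Suc.hyps(2) Suc.prems
      by (simp add: alternating_interior_product)
  qed
  have right: "alternating n (\<alpha> \<and>\<^sub>f interior_product v \<beta>)" for v
  proof (cases l)
    case 0
    then show ?thesis using Suc.prems
      by (simp add: interior_product_alternating_0 wedge_zero_right alternating_zero)
  next
    case (Suc l')
    then show ?thesis
      using Suc.hyps(1)[of k l' \<alpha> "interior_product v \<beta>"] Suc.hyps(2) Suc.prems
      by (simp add: alternating_interior_product)
  qed
  have Cons: "(\<alpha> \<and>\<^sub>f \<beta>) (v # vs) =
    (interior_product v \<alpha> \<and>\<^sub>f \<beta>) vs + (-1) ^ k * (\<alpha> \<and>\<^sub>f interior_product v \<beta>) vs" for v vs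
    by (rule interior_product_wedge) (rule alternating_degree[OF Suc.prems(1)])
  have "alternating (Suc n) (\<alpha> \<and>\<^sub>f \<beta>)"
  proof (rule alternating_SucI)
    show "(\<alpha> \<and>\<^sub>f \<beta>) [] = 0"
      using Suc.prems Suc.hyps(2) by (cases k; cases l) (auto simp: wedge_Nil dest: alternating_degree[of _ _ "[]"])
    show "alternating n (interior_product v (\<alpha> \<and>\<^sub>f \<beta>))" for v
      using alternating_linear_combination[OF left[of v] right[of v], of 1 "(-1) ^ k"] Cons
      by (simp add: interior_product_def[of v "_ \<and>\<^sub>f _"])
    show "linear (\<lambda>v. (\<alpha> \<and>\<^sub>f \<beta>) (v # vs))" for vs
    proof -
      have "linear (\<lambda>v. (interior_product v \<alpha> \<and>\<^sub>f \<beta>) vs)"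
        by (rule linear_wedge_left)
          (simp add: interior_product_def alternating_linear[OF Suc.prems(1)])
      moreover have "linear (\<lambda>v. (\<alpha> \<and>\<^sub>f interior_product v \<beta>) vs)"
        by (rule linear_wedge_right)
          (simp add: interior_product_def alternating_linear[OF Suc.prems(2)])
      ultimately show ?thesis unfolding Cons linear_iff by (simp add: algebra_simps)
    qed
    show "(\<alpha> \<and>\<^sub>f \<beta>) (v # v # vs) = 0" for v vs
    proof (cases k)
      case 0
      then have "(\<alpha> \<and>\<^sub>f interior_product v \<beta>) (v # vs) =
          (interior_product v \<alpha> \<and>\<^sub>f interior_product v \<beta>) vs
          + (-1) ^ 0 * (\<alpha> \<and>\<^sub>f interior_product v (interior_product v \<beta>)) vs"
        using Suc.prems by (intro interior_product_wedge) (auto intro: alternating_degree)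
      then show ?thesis using 0 Suc.prems
        by (simp add: Cons interior_product_alternating_0 wedge_zero_left wedge_zero_right
            interior_product_twice)
    next
      case (Suc k')
      have "(interior_product v \<alpha> \<and>\<^sub>f \<beta>) (v # vs) =
          (interior_product v (interior_product v \<alpha>) \<and>\<^sub>f \<beta>) vs
          + (-1) ^ k' * (interior_product v \<alpha> \<and>\<^sub>f interior_product v \<beta>) vs"
        using Suc.prems Suc
        by (intro interior_product_wedge alternating_degree[OF alternating_interior_product]) auto
      moreover have "(\<alpha> \<and>\<^sub>f interior_product v \<beta>) (v # vs) =
          (interior_product v \<alpha> \<and>\<^sub>f interior_product v \<beta>) vs
          + (-1) ^ k * (\<alpha> \<and>\<^sub>f interior_product v (interior_product v \<beta>)) vs"
        using Suc.prems by (intro interior_product_wedge) (auto intro: alternating_degree)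
      ultimately show ?thesis using Suc Suc.prems
        by (simp add: Cons interior_product_twice wedge_zero_left wedge_zero_right)
    qed
  qed
  then show ?case using Suc.hyps(2) by simp
qed


section \<open>Forms are determined by their values on a basis\<close>

text \<open>An alternating form changes only by a sign under permutations. Only the vanishing matters here, which
  avoids signs altogether: either the two lists begin with the same vector, or the first vector of
  each can be moved to the second place of the other.\<close>

lemma alternating_zero_permute:
  "alternating k \<alpha> \<Longrightarrow> mset us = mset vs \<Longrightarrow> \<alpha> us = 0 \<Longrightarrow> \<alpha> vs = 0"
proof (induction "length us" arbitrary: k \<alpha> us vs)
  case (Suc n)
  obtain u us' where us: "us = u # us'" using Suc.hyps(2) by (cases us) auto
  obtain v vs' where vs: "vs = v # vs'" using Suc.prems(2) us by (cases vs) simp_all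
  show ?case
  proof (cases k)
    case 0
    then show ?thesis using Suc.prems(1) vs by (simp add: alternating_degree)
  next
    case k: (Suc k')
    note ip = alternating_interior_product[OF Suc.prems(1)[unfolded k]]
    have len: "length us' = n" using Suc.hyps(2) us by simp
    show ?thesis
    proof (cases "u = v")
      case True
      then show ?thesis
        using Suc.hyps(1)[OF len[symmetric] ip[of u], of vs'] Suc.prems us vs
        by (simp add: interior_product_def)
    next
      case False
      have eq: "add_mset u (mset us') = add_mset v (mset vs')" using Suc.prems(2) us vs by simp
      define M where "M = mset us' - {#v#}"
      obtain zs where zs: "mset zs = M" using ex_mset by blast
      have us': "mset us' = mset (v # zs)" and vs': "mset vs' = mset (u # zs)"
        using eq False by (auto simp: zs M_def add_eq_conv_ex)
      have "\<alpha> (u # v # zs) = 0"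
        using Suc.hyps(1)[OF len[symmetric] ip[of u] us'] Suc.prems(3) us
        by (simp add: interior_product_def)
      then have "interior_product v \<alpha> (u # zs) = 0"
        using alternating_swap[OF Suc.prems(1), of u v zs] by (simp add: interior_product_def)
      moreover have "n = length (u # zs)" using len us' by (metis length_Cons size_mset)
      ultimately show ?thesis
        using Suc.hyps(1)[of "u # zs" k' "interior_product v \<alpha>" vs'] ip[of v] vs' vs
        by (simp add: interior_product_def)
    qed
  qed
qed auto

lemma multilinear_eq_zero:
  "multilinear k \<alpha> \<Longrightarrow> span B = UNIV \<Longrightarrow> (\<And>us. set us \<subseteq> B \<Longrightarrow> \<alpha> us = 0) \<Longrightarrow> \<alpha> vs = 0"
proof (induction k arbitrary: \<alpha> vs)
  case 0
  then show ?case by (cases "vs = []") (auto simp: multilinear_def)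
next
  case (Suc k)
  show ?case
  proof (cases "\<exists>v ws. vs = v # ws \<and> length ws = k")
    case True
    then obtain v ws where vs: "vs = v # ws" by blast
    have "interior_product v \<alpha> us = 0" if us: "set us \<subseteq> B" for us
    proof (cases "length us = k")
      case True
      then have lin: "linear (\<lambda>v. \<alpha> (v # us))" using Suc.prems(1) by (simp add: multilinear_Suc_iff)
      have "\<alpha> (v # us) = 0"
        by (rule linear_eq_0_on_span[OF lin, of B]) (use us Suc.prems in auto)
      then show ?thesis by (simp add: interior_product_def)
    qed (use Suc.prems(1) in \<open>auto simp: multilinear_def interior_product_def\<close>)
    then have "interior_product v \<alpha> ws = 0"
      using Suc.IH[of "interior_product v \<alpha>"] Suc.prems by (simp add: multilinear_Suc_iff)
    then show ?thesis by (simp add: vs interior_product_def)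
  next
    case False
    then have "length vs \<noteq> Suc k" by (cases vs) auto
    then show ?thesis using Suc.prems(1) by (auto simp: multilinear_def)
  qed
qed

text \<open>One ordering of each \<open>k\<close>-element subset of a basis suffices. The ordering may be chosen freely,
  so bases need not be enumerated.\<close>

lemma alternating_eq_zero:
  assumes alt: "alternating k \<alpha>" and B: "span B = UNIV"
    and zero: "\<And>A. A \<subseteq> B \<Longrightarrow> card A = k \<Longrightarrow> finite A \<Longrightarrow> \<exists>us. distinct us \<and> set us = A \<and> \<alpha> us = 0"
  shows "\<alpha> = (\<lambda>_. 0)"
proof
  fix vs
  show "\<alpha> vs = 0"
  proof (rule multilinear_eq_zero[OF _ B])
    show "multilinear k \<alpha>" using alt by (simp add: alternating_def)
    fix us :: "(real^6) list" assume us: "set us \<subseteq> B"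
    show "\<alpha> us = 0"
    proof (cases "length us = k \<and> distinct us")
      case True
      then obtain ws where "distinct ws" "set ws = set us" "\<alpha> ws = 0"
        using zero[of "set us"] us distinct_card by auto
      then show ?thesis
        using alternating_zero_permute[OF alt, of ws us] True by (simp add: set_eq_iff_mset_eq_distinct)
    next
      case False
      then show ?thesis using alt alternating_degree[OF alt] by (auto simp: alternating_def)
    qed
  qed
qed

text \<open>Complete the vectors to a basis: a 6-form that vanishes on a basis is zero.\<close>

lemma volume_form_extend_independent:
  assumes \<Omega>: "alternating 6 \<Omega>" "\<Omega> \<noteq> (\<lambda>_. 0)" and xs: "distinct xs" "independent (set xs)"
  shows "\<exists>ys. \<Omega> (xs @ ys) \<noteq> 0"
proof (rule ccontr)
  assume no: "\<not> ?thesis"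
  obtain B where B: "set xs \<subseteq> B" "independent B" "UNIV \<subseteq> span B"
    using maximal_independent_subset_extend[of "set xs" UNIV] xs by auto
  have fin: "finite B" using B independent_bound by blast
  have "card B = 6"
    using B basis_card_eq_dim[of B "UNIV :: (real^6) set"] by simp
  obtain ys where ys: "set ys = B - set xs" "distinct ys"
    using finite_distinct_list[of "B - set xs"] fin by auto
  have "\<Omega> = (\<lambda>_. 0)"
  proof (rule alternating_eq_zero[OF \<Omega>(1)])
    show "span B = UNIV" using B by auto
    fix A assume "A \<subseteq> B" "card A = 6"
    then have "A = B" using fin \<open>card B = 6\<close> by (simp add: card_subset_eq)
    then show "\<exists>us. distinct us \<and> set us = A \<and> \<Omega> us = 0"
      using no xs ys B by (intro exI[of _ "xs @ ys"]) auto
  qed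
  then show False using \<Omega> by simp
qed

text \<open>This is the isomorphism between vectors and 5-forms on which Hitchin's map rests. It makes the
  definite description in \<open>hitchin_K\<close> meaningful.\<close>

lemma alternating_5_interior_product:
  assumes \<Omega>: "alternating 6 \<Omega>" "\<Omega> \<noteq> (\<lambda>_. 0)" and \<gamma>: "alternating 5 \<gamma>"
  shows "\<exists>!w. interior_product w \<Omega> = \<gamma>"
proof (rule ex_ex1I)
  define B :: "(real^6) set" where "B = Basis"
  have fin: "finite B" and card: "card B = 6" by (simp_all add: B_def)
  have "\<exists>us. distinct us \<and> set us = B - {b}" for b using finite_distinct_list[of "B - {b}"] fin by auto
  then obtain L where L: "\<And>b. distinct (L b)" "\<And>b. set (L b) = B - {b}" by metis
  have nz: "\<Omega> (b # L b) \<noteq> 0" if "b \<in> B" for b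
  proof
    assume "\<Omega> (b # L b) = 0"
    have "\<Omega> = (\<lambda>_. 0)"
    proof (rule alternating_eq_zero[OF \<Omega>(1)])
      show "span B = UNIV" by (simp add: B_def)
      fix A assume "A \<subseteq> B" "card A = 6"
      then have "A = B" using fin card by (simp add: card_subset_eq)
      then show "\<exists>us. distinct us \<and> set us = A \<and> \<Omega> us = 0"
        using \<open>\<Omega> (b # L b) = 0\<close> L \<open>b \<in> B\<close> by (intro exI[of _ "b # L b"]) auto
    qed
    then show False using \<Omega> by simp
  qed
  \<comment> \<open>Cramer's rule: \<open>\<Omega>(w, L b)\<close> sees only the \<open>b\<close>-component of \<open>w\<close>, since \<open>L b\<close> lists the other basis vectors.\<close>
  define w where "w = (\<Sum>b\<in>B. (\<gamma> (L b) / \<Omega> (b # L b)) *\<^sub>R b)"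
  have "(\<lambda>vs. 1 * interior_product w \<Omega> vs + (-1) * \<gamma> vs) = (\<lambda>_. 0)"
  proof (rule alternating_eq_zero[where k = 5 and B = B])
    show "span B = UNIV" by (simp add: B_def)
    show "alternating 5 (\<lambda>vs. 1 * interior_product w \<Omega> vs + (-1) * \<gamma> vs)"
      by (rule alternating_linear_combination) (use \<Omega> \<gamma> in \<open>auto intro: alternating_interior_product\<close>)
    fix A assume A: "A \<subseteq> B" "card A = 5"
    then have "card (B - A) = 1" using card fin by (simp add: card_Diff_subset finite_subset)
    then obtain b where "B - A = {b}" by (rule card_1_singletonE)
    then have b: "b \<in> B" "A = B - {b}" using A by auto
    note lin = alternating_linear[OF \<Omega>(1), of "L b"]
    have "interior_product w \<Omega> (L b) = (\<Sum>c\<in>B. (\<gamma> (L c) / \<Omega> (c # L c)) * \<Omega> (c # L b))"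
      by (simp add: interior_product_def w_def linear_sum[OF lin] linear_scale[OF lin])
    also have "\<dots> = (\<Sum>c\<in>B. if c = b then \<gamma> (L b) else 0)"
    proof (intro sum.cong refl)
      fix c assume "c \<in> B"
      then have "c \<noteq> b \<Longrightarrow> \<Omega> (c # L b) = 0" using L \<Omega> by (auto simp: alternating_def)
      then show "\<gamma> (L c) / \<Omega> (c # L c) * \<Omega> (c # L b) = (if c = b then \<gamma> (L b) else 0)"
        using nz b by auto
    qed
    also have "\<dots> = \<gamma> (L b)" using b fin by simp
    finally show "\<exists>us. distinct us \<and> set us = A \<and> 1 * interior_product w \<Omega> us + (-1) * \<gamma> us = 0"
      using L b by (intro exI[of _ "L b"]) auto
  qed
  then show "\<exists>w. interior_product w \<Omega> = \<gamma>" by (intro exI[of _ w]) (auto simp: fun_eq_iff)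
next
  fix w w' assume w: "interior_product w \<Omega> = \<gamma>" "interior_product w' \<Omega> = \<gamma>"
  show "w = w'"
  proof (rule ccontr)
    assume "w \<noteq> w'"
    then obtain ys where "\<Omega> ((w - w') # ys) \<noteq> 0"
      using volume_form_extend_independent[OF \<Omega>, of "[w - w']"] by auto
    moreover have "\<Omega> ((w - w') # ys) = interior_product w \<Omega> ys - interior_product w' \<Omega> ys"
      by (simp add: interior_product_def linear_diff[OF alternating_linear[OF \<Omega>(1)]])
    ultimately show False using w by simp
  qed
qed


section \<open>The kernel of a contraction of the 3-form\<close>

lemma wedge_square_2form:
  assumes "alternating 2 \<sigma>"
  shows "(\<sigma> \<and>\<^sub>f \<sigma>) [a, b, c, d] =
    2 * (\<sigma> [a, b] * \<sigma> [c, d] - \<sigma> [a, c] * \<sigma> [b, d] + \<sigma> [a, d] * \<sigma> [b, c])"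
proof -
  have deg: "\<And>vs. length vs \<noteq> 2 \<Longrightarrow> \<sigma> vs = 0"
    by (rule alternating_degree[OF assms])
  have 2: "(\<sigma> \<and>\<^sub>f \<beta>) (v # vs) = (interior_product v \<sigma> \<and>\<^sub>f \<beta>) vs + (\<sigma> \<and>\<^sub>f interior_product v \<beta>) vs"
    for \<beta> v vs by (subst interior_product_wedge[where k = 2]) (auto simp: deg)
  have deg1: "length vs \<noteq> 1 \<Longrightarrow> interior_product u \<sigma> vs = 0" for u vs
    unfolding interior_product_def by (rule deg) simp
  have 1: "(interior_product u \<sigma> \<and>\<^sub>f \<beta>) (v # vs) =
      (interior_product v (interior_product u \<sigma>) \<and>\<^sub>f \<beta>) vs
      - (interior_product u \<sigma> \<and>\<^sub>f interior_product v \<beta>) vs"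
    for \<beta> u v vs
    using interior_product_wedge[of 1 "interior_product u \<sigma>" \<beta> v vs, OF deg1] by simp
  have deg0: "length vs \<noteq> 0 \<Longrightarrow> interior_product w (interior_product u \<sigma>) vs = 0" for u w vs
    unfolding interior_product_def by (rule deg) simp
  have "interior_product v (interior_product w (interior_product u \<sigma>)) = (\<lambda>_. 0)" for u v w
    unfolding interior_product_def by (rule ext, rule deg) simp
  then have 0: "(interior_product w (interior_product u \<sigma>) \<and>\<^sub>f \<beta>) (v # vs) =
      (interior_product w (interior_product u \<sigma>) \<and>\<^sub>f interior_product v \<beta>) vs" for \<beta> u v w vs
    using interior_product_wedge[of 0 "interior_product w (interior_product u \<sigma>)" \<beta> v vs, OF deg0]
    by (simp add: wedge_zero_left)
  show ?thesis
    by (simp add: 0 1 2 wedge_Nil) (simp add: interior_product_def deg algebra_simps)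
qed

lemma interior_product_hitchin_K:
  assumes "alternating 6 \<Omega>" "\<Omega> \<noteq> (\<lambda>_. 0)" "alternating 3 \<psi>"
  shows "interior_product (hitchin_K \<Omega> \<psi> v) \<Omega> = interior_product v \<psi> \<and>\<^sub>f \<psi>"
proof -
  have "alternating 2 (interior_product v \<psi>)"
    using alternating_interior_product[of 2 \<psi> v] assms(3) by simp
  then have "alternating 5 (interior_product v \<psi> \<and>\<^sub>f \<psi>)"
    using alternating_wedge[of 2 "interior_product v \<psi>" 3 \<psi>] assms(3) by simp
  then show ?thesis
    unfolding hitchin_K_def by (rule theI'[OF alternating_5_interior_product[OF assms(1,2)]])
qed

text \<open>Contract \<open>i\<^sub>K\<^sub>v \<Omega> = i\<^sub>v \<psi> \<and> \<psi>\<close> with \<open>v\<close> once more. The formula converts questions about the rank of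
  \<open>i\<^sub>v \<psi>\<close> into questions about linear independence of \<open>K v\<close>, \<open>v\<close> and further vectors.\<close>

lemma volume_hitchin_K:
  assumes "alternating 6 \<Omega>" "\<Omega> \<noteq> (\<lambda>_. 0)" "alternating 3 \<psi>"
  shows "\<Omega> (hitchin_K \<Omega> \<psi> v # v # vs) = (interior_product v \<psi> \<and>\<^sub>f interior_product v \<psi>) vs"
proof -
  have alt: "alternating 2 (interior_product v \<psi>)"
    using alternating_interior_product[of 2 \<psi> v] assms(3) by simp
  have "\<Omega> (hitchin_K \<Omega> \<psi> v # v # vs) = (interior_product v \<psi> \<and>\<^sub>f \<psi>) (v # vs)"
    using fun_cong[OF interior_product_hitchin_K[OF assms, of v], of "v # vs"]
    unfolding interior_product_def[of "hitchin_K \<Omega> \<psi> v"] .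
  also have "\<dots> = (interior_product v \<psi> \<and>\<^sub>f interior_product v \<psi>) vs"
    using assms(3)
    by (subst interior_product_wedge[where k = 2])
      (auto simp: alternating_degree[OF alt] interior_product_twice wedge_zero_left)
  finally show ?thesis .
qed

text \<open>Put \<open>\<sigma> = i\<^sub>v \<psi>\<close> and \<open>\<beta> = \<sigma>(K v, \<cdot>)\<close>. By independence \<open>\<sigma> \<and> \<sigma>\<close> is nonzero, but its contraction with
  \<open>K v\<close>, which is \<open>2 \<beta> \<and> \<sigma>\<close>, vanishes. If \<open>\<beta>\<close> were nonzero, \<open>\<sigma>\<close> would be divisible by \<open>\<beta>\<close>, and
  \<open>\<sigma> \<and> \<sigma>\<close> would be zero.\<close>

lemma hitchin_K_in_kernel:
  assumes alt: "alternating 6 \<Omega>" "\<Omega> \<noteq> (\<lambda>_. 0)" "alternating 3 \<psi>"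
    and indep: "hitchin_K \<Omega> \<psi> v \<noteq> v" "independent {hitchin_K \<Omega> \<psi> v, v}"
  shows "\<psi> [v, hitchin_K \<Omega> \<psi> v, y] = 0"
proof (rule ccontr)
  define K where "K = hitchin_K \<Omega> \<psi> v"
  define \<sigma> where "\<sigma> = interior_product v \<psi>"
  have \<sigma>: "alternating 2 \<sigma>"
    using alternating_interior_product[of 2 \<psi> v] alt(3) by (simp add: \<sigma>_def)
  note vol = volume_hitchin_K[OF alt, of v, folded K_def \<sigma>_def]
  obtain ys where ys: "(\<sigma> \<and>\<^sub>f \<sigma>) ys \<noteq> 0"
    using volume_form_extend_independent[OF alt(1,2), of "[K, v]"] indep vol by (auto simp: K_def)
  moreover have "alternating 4 (\<sigma> \<and>\<^sub>f \<sigma>)" using alternating_wedge[OF \<sigma> \<sigma>] by simp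
  ultimately have "length ys = 4" by (meson alternating_degree)
  then obtain a b c d where abcd: "ys = [a, b, c, d]"
    by (auto simp: length_Suc_conv numeral_eq_Suc)
  assume "\<not> ?thesis"
  then have nz: "\<sigma> [K, y] \<noteq> 0" by (simp add: \<sigma>_def K_def interior_product_def)
  \<comment> \<open>This is \<open>\<sigma> = \<tau> \<and> \<beta>\<close> with \<open>\<tau> = \<sigma>(\<cdot>, y) / \<beta>(y)\<close>.\<close>
  have sigma: "\<sigma> [p, q] = \<sigma> [K, q] * (\<sigma> [p, y] / \<sigma> [K, y]) - \<sigma> [K, p] * (\<sigma> [q, y] / \<sigma> [K, y])" for p q
  proof -
    have "(\<sigma> \<and>\<^sub>f \<sigma>) [K, p, q, y] = \<Omega> [K, v, K, p, q, y]" by (simp add: vol)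
    also have "\<dots> = 0" using alt(1) by (auto simp: alternating_def)
    finally have "\<sigma> [K, p] * \<sigma> [q, y] - \<sigma> [K, q] * \<sigma> [p, y] + \<sigma> [K, y] * \<sigma> [p, q] = 0"
      by (simp add: wedge_square_2form[OF \<sigma>])
    then show ?thesis using nz by (simp add: field_simps)
  qed
  have "(\<sigma> \<and>\<^sub>f \<sigma>) [a, b, c, d] = 0"
    unfolding wedge_square_2form[OF \<sigma>] sigma[of a b] sigma[of a c] sigma[of a d]
      sigma[of b c] sigma[of b d] sigma[of c d]
    by (simp add: algebra_simps)
  then show False using ys abcd by simp
qed

text \<open>A kernel vector outside the span would leave \<open>\<Omega>(K v, v, x, \<dots>)\<close> nonzero for suitable arguments, while
  \<open>(i\<^sub>v \<psi> \<and> i\<^sub>v \<psi>)(x, \<dots>) = 0\<close>.\<close>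

lemma kernel_in_span_hitchin_K:
  assumes alt: "alternating 6 \<Omega>" "\<Omega> \<noteq> (\<lambda>_. 0)" "alternating 3 \<psi>"
    and indep: "hitchin_K \<Omega> \<psi> v \<noteq> v" "independent {hitchin_K \<Omega> \<psi> v, v}"
    and ker: "\<And>y. \<psi> [v, x, y] = 0"
  shows "x \<in> span {hitchin_K \<Omega> \<psi> v, v}"
proof (rule ccontr)
  define K where "K = hitchin_K \<Omega> \<psi> v"
  define \<sigma> where "\<sigma> = interior_product v \<psi>"
  have \<sigma>: "alternating 2 \<sigma>"
    using alternating_interior_product[of 2 \<psi> v] alt(3) by (simp add: \<sigma>_def)
  assume x: "x \<notin> span {hitchin_K \<Omega> \<psi> v, v}"
  then have "independent (insert x {K, v})" "x \<noteq> K" "x \<noteq> v"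
    using indep span_base[of _ "{K, v}"] by (auto simp: independent_insert K_def)
  moreover have "{K, v, x} = insert x {K, v}" by auto
  ultimately obtain ys where ys: "\<Omega> ([K, v, x] @ ys) \<noteq> 0"
    using volume_form_extend_independent[OF alt(1,2), of "[K, v, x]"] indep(1) by (auto simp: K_def)
  then have "length ys = 3" using alternating_degree[OF alt(1), of "[K, v, x] @ ys"] by auto
  then obtain b c d where bcd: "ys = [b, c, d]" by (auto simp: length_Suc_conv numeral_eq_Suc)
  have "\<Omega> [K, v, x, b, c, d] = (\<sigma> \<and>\<^sub>f \<sigma>) [x, b, c, d]"
    unfolding K_def \<sigma>_def by (rule volume_hitchin_K[OF alt])
  moreover have "\<sigma> [x, y] = 0" for y using ker by (simp add: \<sigma>_def interior_product_def)
  ultimately have "\<Omega> [K, v, x, b, c, d] = 0" by (simp add: wedge_square_2form[OF \<sigma>])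
  then show False using ys bcd by simp
qed

lemma alternating_cube:
  assumes "stable_2form \<omega>"
  shows "alternating 6 (cube \<omega>)" "cube \<omega> \<noteq> (\<lambda>_. 0)"
proof -
  have "alternating 2 \<omega>" using assms by (simp add: stable_2form_def)
  then have "alternating (2 + 2 + 2) (cube \<omega>)"
    unfolding cube_def by (intro alternating_wedge)
  then show "alternating 6 (cube \<omega>)" by simp
  show "cube \<omega> \<noteq> (\<lambda>_. 0)" using assms by (simp add: stable_2form_def)
qed

lemma alternating_2_linear:
  assumes "alternating 2 \<omega>"
  shows "linear (\<lambda>v. \<omega> [v, w])" "linear (\<lambda>v. \<omega> [w, v])" "\<omega> [v, w] = - \<omega> [w, v]" "\<omega> [v, v] = 0"
proof -
  show "linear (\<lambda>v. \<omega> [v, w])" by (rule alternating_linear[OF assms])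
  have "alternating 1 (interior_product w \<omega>)"
    using assms by (intro alternating_interior_product) (simp add: numeral_2_eq_2)
  from alternating_linear[OF this, of "[]"] show "linear (\<lambda>v. \<omega> [w, v])"
    by (simp add: interior_product_def)
  show "\<omega> [v, w] = - \<omega> [w, v]" by (rule alternating_swap[OF assms])
  show "\<omega> [v, v] = 0" using assms by (auto simp: alternating_def)
qed

text \<open>Positivity of the metric: \<open>\<omega>(v, J v) = h(v, v) > 0\<close> and \<open>J v\<close> is a multiple of \<open>K v\<close>, so \<open>K v\<close>
  cannot be a multiple of \<open>v\<close>.\<close>

lemma su3_K_independent:
  assumes su3: "linear_su3_structure \<omega> \<psi>" and v: "v \<noteq> 0"
  defines "K \<equiv> hitchin_K (cube \<omega>) \<psi> v"
  shows "K \<noteq> v \<and> independent {K, v}" and "\<omega> [v, K] \<noteq> 0"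
proof -
  have \<omega>: "alternating 2 \<omega>" using su3 by (simp add: linear_su3_structure_def stable_2form_def)
  have "su3_metric \<omega> \<psi> [v, v] > 0"
    using su3 v by (auto simp: linear_su3_structure_def inner_product_def)
  then have "\<omega> [v, su3_J \<omega> \<psi> v] \<noteq> 0" by (simp add: su3_metric_def)
  then show *: "\<omega> [v, K] \<noteq> 0"
    by (auto simp: su3_J_def hitchin_J_def K_def linear_scale[OF alternating_2_linear(2)[OF \<omega>]]
        linear_neg[OF alternating_2_linear(2)[OF \<omega>]])
  have "K \<notin> span {v}"
  proof
    assume "K \<in> span {v}"
    then obtain c where "K = c *\<^sub>R v" by (auto simp: span_singleton)
    then show False
      using * by (simp add: linear_scale[OF alternating_2_linear(2)[OF \<omega>]] alternating_2_linear(4)[OF \<omega>])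
  qed
  moreover from this have "K \<noteq> v" using span_base[of v "{v}"] by auto
  ultimately show "K \<noteq> v \<and> independent {K, v}"
    using v by (simp add: independent_insert)
qed

lemma su3_J_in_kernel:
  assumes su3: "linear_su3_structure \<omega> \<psi>"
  shows "\<psi> [v, su3_J \<omega> \<psi> v, y] = 0"
proof (cases "v = 0")
  case True
  have "linear (\<lambda>v. \<psi> [v, w, y])" for w
    using alternating_linear[of 3 \<psi>] su3 by (simp add: linear_su3_structure_def)
  then show ?thesis using True linear_0[of "\<lambda>v. \<psi> [v, _, y]"] by simp
next
  case False
  have \<psi>: "alternating 3 \<psi>" and \<omega>: "stable_2form \<omega>" using su3 by (auto simp: linear_su3_structure_def)
  have lin: "linear (\<lambda>w. \<psi> [v, w, y])"
    using alternating_linear[OF alternating_interior_product[of 2 \<psi> v], of "[y]"] \<psi>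
    by (simp add: interior_product_def)
  have "\<psi> [v, hitchin_K (cube \<omega>) \<psi> v, y] = 0"
    using su3_K_independent[OF su3 False] by (intro hitchin_K_in_kernel alternating_cube \<psi> \<omega>) auto
  then show ?thesis
    by (simp add: su3_J_def hitchin_J_def linear_scale[OF lin] linear_neg[OF lin])
qed

text \<open>The 2-form \<open>\<omega>\<close> is nondegenerate because \<open>\<omega>(d, J d) = h(d, d) > 0\<close>. The lemma finds the preimage of
  a vector under \<open>J\<close> by metric duality, which bypasses the identity \<open>J\<^sup>2 = -1\<close>.\<close>

lemma su3_J_eqI:
  assumes su3: "linear_su3_structure \<omega> \<psi>"
    and z: "\<And>y. su3_metric \<omega> \<psi> [y, z] = \<omega> [y, v]"
  shows "su3_J \<omega> \<psi> z = v"
proof (rule ccontr)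
  have \<omega>: "alternating 2 \<omega>" using su3 by (simp add: linear_su3_structure_def stable_2form_def)
  define d where "d = su3_J \<omega> \<psi> z - v"
  assume "\<not> ?thesis"
  then have "su3_metric \<omega> \<psi> [d, d] > 0"
    using su3 by (simp add: d_def linear_su3_structure_def inner_product_def)
  then have "\<omega> [d, su3_J \<omega> \<psi> d] > 0" by (simp add: su3_metric_def)
  moreover have "\<omega> [su3_J \<omega> \<psi> d, d] = 0"
    using z unfolding d_def
    by (simp add: linear_diff[OF alternating_2_linear(2)[OF \<omega>]] su3_metric_def)
  ultimately show False using alternating_2_linear(3)[OF \<omega>, of d "su3_J \<omega> \<psi> d"] by simp
qed

text \<open>In the kernel, which is the span of \<open>v\<close> and \<open>K v\<close>, the condition \<open>\<omega>(v, x) = 0\<close> kills the component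
  along \<open>K v\<close>.\<close>

lemma su3_kernel:
  assumes su3: "linear_su3_structure \<omega> \<psi>" and v: "v \<noteq> 0"
    and x: "\<And>y. \<psi> [v, x, y] = 0" "\<omega> [v, x] = 0"
  shows "x \<in> span {v}"
proof -
  define K where "K = hitchin_K (cube \<omega>) \<psi> v"
  note K = su3_K_independent[OF su3 v, folded K_def]
  have \<omega>: "alternating 2 \<omega>" using su3 by (simp add: linear_su3_structure_def stable_2form_def)
  have "x \<in> span {K, v}"
    unfolding K_def
    by (rule kernel_in_span_hitchin_K)
      (use su3 K x(1) in \<open>auto simp: linear_su3_structure_def alternating_cube K_def\<close>)
  then obtain k where k: "x - k *\<^sub>R K \<in> span {v}" by (auto simp: span_insert)
  then obtain c where c: "x - k *\<^sub>R K = c *\<^sub>R v" by (auto simp: span_singleton)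
  then have "x = k *\<^sub>R K + c *\<^sub>R v" by (simp add: algebra_simps)
  then have "\<omega> [v, x] = k * \<omega> [v, K]"
    by (simp add: linear_add[OF alternating_2_linear(2)[OF \<omega>]]
        linear_scale[OF alternating_2_linear(2)[OF \<omega>]] alternating_2_linear(4)[OF \<omega>])
  then have "k = 0" using x K by simp
  then show ?thesis using k by simp
qed


section \<open>Solvable Lie algebras with a dominant central root\<close>

lemma alternating_3_linear:
  assumes "alternating 3 \<psi>"
  shows "linear (\<lambda>u. \<psi> [u, v, w])" "linear (\<lambda>u. \<psi> [v, w, u])"
proof -
  have alt: "alternating 2 (interior_product v \<psi>)"
    using alternating_interior_product[of 2 \<psi> v] assms by simp
  show "linear (\<lambda>u. \<psi> [u, v, w])" by (rule alternating_linear[OF assms])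
  show "linear (\<lambda>u. \<psi> [v, w, u])"
    using alternating_2_linear(2)[OF alt] by (simp add: interior_product_def)
qed

text \<open>This is \<open>de\<^sup>i(E\<^sub>a, E\<^sub>b) = - e\<^sup>i([E\<^sub>a, E\<^sub>b])\<close> for the frame \<open>E\<close> dual to \<open>e\<close>.\<close>

definition structure_constant :: "structure_equations \<Rightarrow> nat \<Rightarrow> nat \<Rightarrow> nat \<Rightarrow> real" where
  "structure_constant S i a b =
     (\<Sum>(c, j, k)\<leftarrow>S ! (i - 1). c * (of_bool (j = a \<and> k = b) - of_bool (j = b \<and> k = a)))"

lemma structure_constant_antisym: "structure_constant S i a b = - structure_constant S i b a"
proof -
  have "(\<Sum>(c, j, k)\<leftarrow>xs. c * (of_bool (j = a \<and> k = b) - of_bool (j = b \<and> k = a)) :: real) =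
    - (\<Sum>(c, j, k)\<leftarrow>xs. c * (of_bool (j = b \<and> k = a) - of_bool (j = a \<and> k = b)))" for xs
    by (induction xs) (auto simp: algebra_simps)
  then show ?thesis by (simp add: structure_constant_def)
qed

text \<open>The indices in \<open>N\<close> span the ideal \<open>\<nn>\<close> and those in \<open>A\<close> its abelian complement \<open>\<aa>\<close>. The root of \<open>E\<^sub>k\<close>
  is \<open>a \<mapsto> structure_constant S k k a\<close>, so the last two lines say that the root of the
  central vector \<open>E\<^sub>m\<close> is nonzero and has nonnegative inner products with all the roots.\<close>

definition dominant_central_root :: "structure_equations \<Rightarrow> nat set \<Rightarrow> nat set \<Rightarrow> nat \<Rightarrow> bool" where
  "dominant_central_root S N A m \<longleftrightarrow>
     N \<union> A = {1..6} \<and> N \<inter> A = {} \<and> m \<in> N \<and> N \<noteq> {m} \<and>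
     (\<forall>i\<in>A. \<forall>a\<in>{1..6}. \<forall>b\<in>{1..6}. structure_constant S i a b = 0) \<and>
     (\<forall>i\<in>N. \<forall>a\<in>A. \<forall>b\<in>A. structure_constant S i a b = 0) \<and>
     (\<forall>i\<in>N. \<forall>k\<in>N. \<forall>a\<in>A. i \<noteq> k \<longrightarrow> structure_constant S i k a = 0) \<and>
     (\<forall>i\<in>N. \<forall>k\<in>N. structure_constant S i m k = 0) \<and>
     (\<Sum>a\<in>A. structure_constant S m m a * structure_constant S m m a) > 0 \<and>
     (\<forall>k\<in>N. (\<Sum>a\<in>A. structure_constant S m m a * structure_constant S k k a) \<ge> 0)"

text \<open>The last hypothesis is \<open>d\<omega> = c \<psi>\<close> evaluated on the frame. The computation takes place in
  coordinates \<open>x\<^sub>k = \<omega>(E\<^sub>k, E\<^sub>m)\<close>, which are those of the vector \<open>z\<close> with \<open>J z = E\<^sub>m\<close>.\<close>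

lemma no_coupled_of_dominant_central_root:
  fixes E :: "nat \<Rightarrow> real^6" and e :: "nat \<Rightarrow> covariant"
  assumes su3: "linear_su3_structure \<omega> \<psi>"
    and root: "dominant_central_root S N A m"
    and dual: "\<And>i j. i \<in> {1..6} \<Longrightarrow> j \<in> {1..6} \<Longrightarrow> e i [E j] = of_bool (i = j)"
    and expand: "\<And>v. v = (\<Sum>i\<in>{1..6}. e i [v] *\<^sub>R E i)"
    and e_lin: "\<And>i. i \<in> {1..6} \<Longrightarrow> linear (\<lambda>v. e i [v])"
    and metric: "\<And>v w. su3_metric \<omega> \<psi> [v, w] = (\<Sum>i\<in>{1..6}. e i [v] * e i [w])"
    and c: "c \<noteq> 0"
    and coupled: "\<And>a b d. a \<in> {1..6} \<Longrightarrow> b \<in> {1..6} \<Longrightarrow> d \<in> {1..6} \<Longrightarrow> c * \<psi> [E a, E b, E d] =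
      (\<Sum>i\<in>{1..6}. structure_constant S i a b * \<omega> [E i, E d]
        - structure_constant S i a d * \<omega> [E i, E b]
        + structure_constant S i b d * \<omega> [E i, E a])"
  shows False
proof -
  let ?s = "structure_constant S"
  have \<omega>: "alternating 2 \<omega>" and \<psi>: "alternating 3 \<psi>"
    using su3 by (simp_all add: linear_su3_structure_def stable_2form_def)
  note lin2 = alternating_2_linear[OF \<omega>] and lin3 = alternating_3_linear[OF \<psi>]
  have NA: "{1..6} = N \<union> A" and disj: "N \<inter> A = {}" and mN: "m \<in> N"
    using root by (simp_all add: dominant_central_root_def)
  have "finite (N \<union> A)" unfolding NA[symmetric] by simp
  then have fin: "finite N" "finite A" by auto
  have m: "m \<in> N" "m \<in> {1..6}" using mN NA by auto
  define \<alpha> where "\<alpha> = (\<lambda>k a. ?s k k a)"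
  note rootD = root[unfolded dominant_central_root_def NA]
  have sA: "?s i a b = 0" if "i \<in> A" "a \<in> N \<union> A" "b \<in> N \<union> A" for i a b
    using rootD that by blast
  have sAA: "?s i a b = 0" if "i \<in> N" "a \<in> A" "b \<in> A" for i a b
    using rootD that by blast
  have sNA: "?s i k a = (if i = k then \<alpha> k a else 0)" if "i \<in> N" "k \<in> N" "a \<in> A" for i k a
    using rootD that unfolding \<alpha>_def by auto
  have sm: "?s i m k = 0" if "i \<in> N" "k \<in> N" for i k
    using rootD that by blast
  have pos: "(\<Sum>a\<in>A. \<alpha> m a * \<alpha> m a) > 0" using rootD unfolding \<alpha>_def by blast
  have nonneg: "(\<Sum>a\<in>A. \<alpha> m a * \<alpha> k a) \<ge> 0" if "k \<in> N" for k
    using rootD that unfolding \<alpha>_def by blast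
  have sAN: "?s i a k = (if i = k then - \<alpha> k a else 0)" if "i \<in> N" "k \<in> N" "a \<in> A" for i k a
    using sNA[OF that] structure_constant_antisym[of S i a k] by simp
  have sm': "?s i k m = 0" if "i \<in> N" "k \<in> N" for i k
    using sm[OF that] structure_constant_antisym[of S i k m] by simp
  define W where "W = (\<lambda>i j. \<omega> [E i, E j])"
  have W_anti: "W i j = - W j i" for i j unfolding W_def by (rule lin2)
  define x where "x = (\<lambda>k. W k m)"
  define q where "q = (\<Sum>a\<in>A. \<alpha> m a * \<alpha> m a)"
  define p where "p = (\<lambda>k. \<Sum>a\<in>A. \<alpha> m a * \<alpha> k a)"
  \<comment> \<open>\<open>T a b d\<close> is the value of \<open>d\<omega>\<close> on three frame vectors; indices \<open>i\<close> of \<open>\<aa>\<close> contribute nothing as \<open>de\<^sup>i = 0\<close>.\<close>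
  define T where "T = (\<lambda>a b d. \<Sum>i\<in>N. ?s i a b * W i d - ?s i a d * W i b + ?s i b d * W i a)"
  have T: "c * \<psi> [E a, E b, E d] = T a b d" if "a \<in> N \<union> A" "b \<in> N \<union> A" "d \<in> N \<union> A" for a b d
  proof -
    have "c * \<psi> [E a, E b, E d] = (\<Sum>i\<in>N \<union> A. ?s i a b * W i d - ?s i a d * W i b + ?s i b d * W i a)"
      using coupled[of a b d] that unfolding W_def NA by simp
    also have "\<dots> = T a b d"
      using that unfolding T_def by (subst sum.union_disjoint) (auto simp: disj fin sA)
    finally show ?thesis .
  qed
  define z where "z = (\<Sum>k\<in>N \<union> A. x k *\<^sub>R E k)"
  have e_z: "e i [z] = x i" if "i \<in> N \<union> A" for i
  proof -
    have i: "i \<in> {1..6}" unfolding NA by (rule that)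
    have "e i [z] = (\<Sum>k\<in>N \<union> A. x k * e i [E k])"
      by (simp add: z_def linear_sum[OF e_lin[OF i]] linear_scale[OF e_lin[OF i]])
    also have "\<dots> = (\<Sum>k\<in>N \<union> A. if k = i then x i else 0)"
      by (rule sum.cong) (use dual[unfolded NA, of i] that in auto)
    finally show ?thesis using that fin by simp
  qed
  have "su3_metric \<omega> \<psi> [y, z] = \<omega> [y, E m]" for y
  proof -
    have "\<omega> [y, E m] = \<omega> [\<Sum>i\<in>N \<union> A. e i [y] *\<^sub>R E i, E m]"
      using expand[of y, unfolded NA] by simp
    also have "\<dots> = (\<Sum>i\<in>N \<union> A. e i [y] * x i)"
      by (simp add: linear_sum[OF lin2(1)] linear_scale[OF lin2(1)] x_def W_def)
    also have "\<dots> = su3_metric \<omega> \<psi> [y, z]" by (simp add: metric[unfolded NA] e_z)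
    finally show ?thesis ..
  qed
  then have "su3_J \<omega> \<psi> z = E m" by (rule su3_J_eqI[OF su3])
  then have "\<psi> [z, E m, y] = 0" for y using su3_J_in_kernel[OF su3, of z] by metis
  then have T0: "(\<Sum>k\<in>N \<union> A. x k * T k m a) = 0" if "a \<in> A" for a
  proof -
    have "0 = c * \<psi> [z, E m, E a]" using \<open>\<And>y. \<psi> [z, E m, y] = 0\<close> by simp
    also have "\<dots> = (\<Sum>k\<in>N \<union> A. x k * (c * \<psi> [E k, E m, E a]))"
      by (simp add: z_def linear_sum[OF lin3(1)] linear_scale[OF lin3(1)] sum_distrib_left algebra_simps)
    also have "\<dots> = (\<Sum>k\<in>N \<union> A. x k * T k m a)"
      using that m by (intro sum.cong refl) (simp add: T)
    finally show ?thesis ..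
  qed
  \<comment> \<open>The structure constants leave one or two terms of \<open>T k m a\<close>, depending on where \<open>k\<close> lies.\<close>
  have TN: "T k m a = - (\<alpha> k a + \<alpha> m a) * x k" if "k \<in> N" "a \<in> A" for k a
  proof -
    have "T k m a = (\<Sum>i\<in>N. (if i = k then - \<alpha> k a * x k else 0) + (if i = m then \<alpha> m a * W m k else 0))"
      unfolding T_def by (rule sum.cong) (use that m in \<open>auto simp: sm' sNA x_def\<close>)
    also have "\<dots> = - \<alpha> k a * x k + \<alpha> m a * W m k" using that m fin by (simp add: sum.distrib)
    also have "\<dots> = - (\<alpha> k a + \<alpha> m a) * x k" by (simp add: W_anti[of m k] x_def algebra_simps)
    finally show ?thesis .
  qed
  have TA: "T k m a = \<alpha> m k * x a - \<alpha> m a * x k" if "k \<in> A" "a \<in> A" for k a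
  proof -
    have "T k m a = (\<Sum>i\<in>N. if i = m then - \<alpha> m k * W m a + \<alpha> m a * W m k else 0)"
      unfolding T_def by (rule sum.cong) (use that m in \<open>auto simp: sAN sAA sNA\<close>)
    also have "\<dots> = - \<alpha> m k * W m a + \<alpha> m a * W m k" using m fin by simp
    finally show ?thesis by (simp add: W_anti[of m] x_def)
  qed
  \<comment> \<open>Combining the equations \<open>T0\<close> with the weights \<open>\<alpha> m a\<close> evaluates \<open>d\<omega>(z, E\<^sub>m, \<cdot>)\<close> on the vector dual to the root of \<open>E\<^sub>m\<close>.\<close>
  have "0 = (\<Sum>a\<in>A. \<alpha> m a * (\<Sum>k\<in>N \<union> A. x k * T k m a))" using T0 by simp
  also have "\<dots> = (\<Sum>a\<in>A. \<alpha> m a * (\<Sum>k\<in>N. - (\<alpha> k a + \<alpha> m a) * (x k)\<^sup>2))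
      + (\<Sum>a\<in>A. \<alpha> m a * (\<Sum>k\<in>A. \<alpha> m k * x a * x k - \<alpha> m a * (x k)\<^sup>2))"
    unfolding sum.distrib[symmetric]
  proof (rule sum.cong[OF refl])
    fix a assume a: "a \<in> A"
    have "(\<Sum>k\<in>N \<union> A. x k * T k m a) = (\<Sum>k\<in>N. x k * T k m a) + (\<Sum>k\<in>A. x k * T k m a)"
      using disj fin by (simp add: sum.union_disjoint)
    also have "\<dots> = (\<Sum>k\<in>N. - (\<alpha> k a + \<alpha> m a) * (x k)\<^sup>2) + (\<Sum>k\<in>A. \<alpha> m k * x a * x k - \<alpha> m a * (x k)\<^sup>2)"
      using a by (simp add: TN TA power2_eq_square algebra_simps)
    finally show "\<alpha> m a * (\<Sum>k\<in>N \<union> A. x k * T k m a) =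
        \<alpha> m a * (\<Sum>k\<in>N. - (\<alpha> k a + \<alpha> m a) * (x k)\<^sup>2) +
        \<alpha> m a * (\<Sum>k\<in>A. \<alpha> m k * x a * x k - \<alpha> m a * (x k)\<^sup>2)"
      by (simp add: distrib_left)
  qed
  also have "(\<Sum>a\<in>A. \<alpha> m a * (\<Sum>k\<in>N. - (\<alpha> k a + \<alpha> m a) * (x k)\<^sup>2)) = - (\<Sum>k\<in>N. (p k + q) * (x k)\<^sup>2)"
  proof -
    have "(\<Sum>a\<in>A. \<alpha> m a * (\<Sum>k\<in>N. - (\<alpha> k a + \<alpha> m a) * (x k)\<^sup>2)) =
      (\<Sum>k\<in>N. \<Sum>a\<in>A. \<alpha> m a * (- (\<alpha> k a + \<alpha> m a) * (x k)\<^sup>2))"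
      unfolding sum_distrib_left by (rule sum.swap)
    also have "\<dots> = (\<Sum>k\<in>N. - ((p k + q) * (x k)\<^sup>2))"
    proof (rule sum.cong[OF refl])
      fix k
      have "(\<Sum>a\<in>A. \<alpha> m a * (- (\<alpha> k a + \<alpha> m a) * (x k)\<^sup>2)) =
          (\<Sum>a\<in>A. - (x k)\<^sup>2 * (\<alpha> m a * \<alpha> k a + \<alpha> m a * \<alpha> m a))"
        by (rule sum.cong) (simp_all add: algebra_simps)
      also have "\<dots> = - (x k)\<^sup>2 * (p k + q)"
        unfolding sum_distrib_left[symmetric] sum.distrib p_def q_def ..
      finally show "(\<Sum>a\<in>A. \<alpha> m a * (- (\<alpha> k a + \<alpha> m a) * (x k)\<^sup>2)) = - ((p k + q) * (x k)\<^sup>2)"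
        by (simp add: algebra_simps)
    qed
    finally show ?thesis by (simp add: sum_negf)
  qed
  also have "(\<Sum>a\<in>A. \<alpha> m a * (\<Sum>k\<in>A. \<alpha> m k * x a * x k - \<alpha> m a * (x k)\<^sup>2)) =
      (\<Sum>a\<in>A. \<alpha> m a * x a)\<^sup>2 - q * (\<Sum>k\<in>A. (x k)\<^sup>2)"
  proof -
    have "(\<Sum>a\<in>A. \<alpha> m a * x a)\<^sup>2 = (\<Sum>a\<in>A. \<Sum>k\<in>A. (\<alpha> m a * x a) * (\<alpha> m k * x k))"
      by (simp add: power2_eq_square sum_product)
    moreover have "q * (\<Sum>k\<in>A. (x k)\<^sup>2) = (\<Sum>a\<in>A. \<Sum>k\<in>A. \<alpha> m a * \<alpha> m a * (x k)\<^sup>2)"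
      by (simp add: q_def sum_product)
    ultimately show ?thesis
      by (simp add: sum_distrib_left right_diff_distrib sum_subtractf algebra_simps)
  qed
  finally have "(\<Sum>k\<in>N. (p k + q) * (x k)\<^sup>2) = (\<Sum>a\<in>A. \<alpha> m a * x a)\<^sup>2 - q * (\<Sum>k\<in>A. (x k)\<^sup>2)" by simp
  also have "\<dots> \<le> 0"
    using Cauchy_Schwarz_ineq_sum[of "\<alpha> m" x A] by (simp add: q_def power2_eq_square)
  finally have le0: "(\<Sum>k\<in>N. (p k + q) * (x k)\<^sup>2) \<le> 0" .
  have pq: "p k + q > 0" if "k \<in> N" for k using nonneg[OF that] pos by (simp add: p_def q_def)
  have x0: "x k = 0" if "k \<in> N" for k
  proof -
    have "0 \<le> (p k + q) * (x k)\<^sup>2" if "k \<in> N" for k using pq[OF that] by simp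
    then have "(p k + q) * (x k)\<^sup>2 = 0"
      using le0 that sum_nonneg_eq_0_iff[OF fin(1), of "\<lambda>k. (p k + q) * (x k)\<^sup>2"]
      by (metis (no_types, lifting) order_antisym sum_nonneg)
    then show ?thesis using pq[OF that] by simp
  qed
  \<comment> \<open>Now \<open>\<omega>(E\<^sub>m, \<cdot>)\<close> vanishes on \<open>\<nn>\<close>, and any second vector \<open>E\<^sub>k\<close> of \<open>\<nn>\<close> lies in the kernel of \<open>\<psi>(E\<^sub>m, \<cdot>, \<cdot>)\<close>.\<close>
  obtain k where k: "k \<in> N" "k \<noteq> m" using root m by (auto simp: dominant_central_root_def)
  have "T m k a = 0" if "a \<in> N \<union> A" for a
    unfolding T_def
  proof (rule sum.neutral, rule ballI)
    fix i assume i: "i \<in> N"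
    have Wi: "W i m = 0" using x0[OF i] by (simp add: x_def)
    show "?s i m k * W i a - ?s i m a * W i k + ?s i k a * W i m = 0"
    proof (cases "a \<in> N")
      case False
      then have "?s i m a = (if i = m then \<alpha> m a else 0)" using that i m by (intro sNA) auto
      moreover have "W m k = 0" using x0[OF k(1)] W_anti[of m k] by (simp add: x_def)
      ultimately show ?thesis using sm[OF i k(1)] Wi by auto
    qed (simp add: sm i k Wi)
  qed
  then have \<psi>0: "\<psi> [E m, E k, E a] = 0" if "a \<in> N \<union> A" for a
    using T[of m k a] m k c that by simp
  have "\<psi> [E m, E k, y] = 0" for y
  proof -
    have "\<psi> [E m, E k, y] = \<psi> [E m, E k, \<Sum>i\<in>N \<union> A. e i [y] *\<^sub>R E i]"
      using expand[of y, unfolded NA] by simp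
    also have "\<dots> = 0"
      by (simp add: linear_sum[OF lin3(2)] linear_scale[OF lin3(2)] \<psi>0)
    finally show ?thesis .
  qed
  moreover have "\<omega> [E m, E k] = 0"
    using x0[OF k(1)] W_anti[of m k] by (simp add: x_def W_def)
  moreover have "e m [E m] = 1" using dual m by simp
  then have "E m \<noteq> 0" using linear_0[OF e_lin[OF m(2)]] by auto
  ultimately have "E k \<in> span {E m}" by (intro su3_kernel[OF su3])
  then obtain t where t: "E k = t *\<^sub>R E m" by (auto simp: span_singleton)
  have k6: "k \<in> {1..6}" unfolding NA using k by simp
  have "1 = e k [E k]" using dual[OF k6 k6] by simp
  also have "\<dots> = t * e k [E m]" by (simp add: t linear_scale[OF e_lin[OF k6]])
  also have "\<dots> = 0" using dual[OF k6 m(2)] k by simp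
  finally show False by simp
qed


section \<open>The Einstein solvable Lie algebras of nonpositive curvature\<close>

lemma atLeastAtMost_1_6: "{1..6} = {1, 2, 3, 4, 5, 6::nat}" by auto

text \<open>In this and the other algebras with nonabelian \<open>\<nn>\<close>, the index \<open>m\<close> is chosen such that \<open>E\<^sub>m\<close> is, up
  to a factor, an iterated bracket of vectors of \<open>\<nn>\<close>. Its root is then the sum of their roots.\<close>

lemma dominant_central_root_s1:
  "r > 0 \<Longrightarrow> dominant_central_root (\<ss>1 r) {1, 2, 3, 4, 5} {6} 5"
  unfolding dominant_central_root_def atLeastAtMost_1_6
  by (simp add: structure_constant_def \<ss>1_def insert_commute)

lemma dominant_central_root_s5:
  "r > 0 \<Longrightarrow> dominant_central_root (\<ss>5 r) {1, 2, 3, 4, 5} {6} 4"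
  unfolding dominant_central_root_def atLeastAtMost_1_6
  by (simp add: structure_constant_def \<ss>5_def insert_commute)

lemma dominant_central_root_s8:
  "r > 0 \<Longrightarrow> dominant_central_root (\<ss>8 r) {1, 2, 3, 4, 5} {6} 3"
  unfolding dominant_central_root_def atLeastAtMost_1_6
  by (simp add: structure_constant_def \<ss>8_def insert_commute)

lemma dominant_central_root_s9:
  "r > 0 \<Longrightarrow> dominant_central_root (\<ss>9 r) {1, 2, 3, 4, 5} {6} 1"
  unfolding dominant_central_root_def atLeastAtMost_1_6
  by (simp add: structure_constant_def \<ss>9_def insert_commute)

text \<open>The parameter makes the off-diagonal square root vanish, so that the action of \<open>\<aa>\<close> is diagonal.\<close>

lemma dominant_central_root_s10:
  "r > 0 \<Longrightarrow> dominant_central_root (\<ss>10 r (1 / sqrt 22)) {1, 2, 3, 4} {5, 6} 3"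
  unfolding dominant_central_root_def atLeastAtMost_1_6
  by (simp add: structure_constant_def \<ss>10_def power_divide insert_commute)

lemma dominant_central_root_s11:
  "r > 0 \<Longrightarrow> dominant_central_root (\<ss>11 r) {1, 2, 3, 4} {5, 6} 4"
  unfolding dominant_central_root_def atLeastAtMost_1_6
  by (simp add: structure_constant_def \<ss>11_def field_simps insert_commute)

lemma dominant_central_root_s12_0_0:
  "r > 0 \<Longrightarrow> dominant_central_root (\<ss>12 r 0 0) {1, 2, 3, 4} {5, 6} 1"
  unfolding dominant_central_root_def atLeastAtMost_1_6
  by (simp add: structure_constant_def \<ss>12_def insert_commute)

lemma dominant_central_root_s12_1_1:
  "r > 0 \<Longrightarrow> dominant_central_root (\<ss>12 r 1 1) {1, 2, 3, 4} {5, 6} 1"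
  unfolding dominant_central_root_def atLeastAtMost_1_6
  by (simp add: structure_constant_def \<ss>12_def field_simps insert_commute)

lemma dominant_central_root_s13:
  "r > 0 \<Longrightarrow> dominant_central_root (\<ss>13 r) {1, 2, 3} {4, 5, 6} 1"
  unfolding dominant_central_root_def atLeastAtMost_1_6
  by (simp add: structure_constant_def \<ss>13_def field_simps insert_commute)

lemma nikitenko_nikonorov_dominant_central_root:
  assumes "r > 0" and "S \<in> nikitenko_nikonorov r"
  shows "\<exists>N A m. dominant_central_root S N A m"
  using assms unfolding nikitenko_nikonorov_def
  by (blast intro: dominant_central_root_s1 dominant_central_root_s5 dominant_central_root_s8 dominant_central_root_s9 dominant_central_root_s10 dominant_central_root_s11 dominant_central_root_s12_0_0 dominant_central_root_s12_1_1 dominant_central_root_s13)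


section \<open>Left invariant frames and the exterior derivative\<close>

text \<open>Since \<open>g\<close> is definite, the six functionals separate points, hence form a basis of the dual
  space.\<close>

lemma dual_frame:
  fixes e :: "nat \<Rightarrow> covariant" and g :: covariant
  assumes g: "inner_product g" and ge: "\<And>v w. g [v, w] = (\<Sum>i\<in>{1..6}. e i [v] * e i [w])"
    and lin: "\<And>i. i \<in> {1..6} \<Longrightarrow> linear (\<lambda>v. e i [v])"
  obtains E :: "nat \<Rightarrow> real^6" where
    "\<And>i j. i \<in> {1..6} \<Longrightarrow> j \<in> {1..6} \<Longrightarrow> e i [E j] = of_bool (i = j)"
    "\<And>v. v = (\<Sum>i\<in>{1..6}. e i [v] *\<^sub>R E i)"
proof -
  have zero: "v = 0" if "\<And>i. i \<in> {1..6} \<Longrightarrow> e i [v] = 0" for v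
  proof (rule ccontr)
    assume "v \<noteq> 0"
    then have "g [v, v] > 0" using g by (simp add: inner_product_def)
    moreover have "g [v, v] = 0" unfolding ge using that by (intro sum.neutral) auto
    ultimately show False by simp
  qed
  \<comment> \<open>The type \<open>6\<close> of coordinates and the indices 1 to 6 are matched by an arbitrary bijection.\<close>
  obtain b :: "nat \<Rightarrow> 6" where b: "bij_betw b {1..6} UNIV"
    using ex_bij_betw_nat_finite_1[of "UNIV :: 6 set"] by auto
  define n where "n = the_inv_into {1..6} b"
  have n: "n k \<in> {1..6}" "b (n k) = k" for k
    using b the_inv_into_into[of b "{1..6}" k "{1..6}"] f_the_inv_into_f[of b "{1..6}" k]
    by (auto simp: n_def bij_betw_def)
  have nb: "n (b i) = i" if "i \<in> {1..6}" for i
    using b that unfolding n_def by (intro the_inv_into_f_f) (auto simp: bij_betw_def)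
  define f :: "real^6 \<Rightarrow> real^6" where "f = (\<lambda>v. \<chi> k. e (n k) [v])"
  have f: "linear f"
    using lin[OF n(1)] by (simp add: f_def linear_iff vec_eq_iff)
  have "inj f"
    unfolding linear_injective_0[OF f]
  proof (intro allI impI)
    fix v assume "f v = 0"
    show "v = 0"
    proof (rule zero)
      fix i :: nat assume "i \<in> {1..6}"
      then have "e i [v] = f v $ b i" by (simp only: f_def vec_lambda_beta nb)
      then show "e i [v] = 0" using \<open>f v = 0\<close> by simp
    qed
  qed
  then have "surj f" by (rule linear_injective_imp_surjective[OF f _ refl])
  then obtain E' where E': "\<And>w. f (E' w) = w" by (metis surjD)
  define E where "E = (\<lambda>j. E' (axis (b j) 1))"
  have dual: "e i [E j] = of_bool (i = j)" if "i \<in> {1..6}" "j \<in> {1..6}" for i j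
  proof -
    have "e i [E j] = f (E j) $ b i" by (simp only: f_def vec_lambda_beta nb[OF that(1)])
    also have "\<dots> = of_bool (b i = b j)" unfolding E_def E' by (auto simp: axis_def)
    also have "b i = b j \<longleftrightarrow> i = j" using bij_betw_imp_inj_on[OF b] that by (rule inj_on_eq_iff)
    finally show ?thesis .
  qed
  moreover have "v = (\<Sum>i\<in>{1..6}. e i [v] *\<^sub>R E i)" for v
  proof -
    have "e i [v - (\<Sum>j\<in>{1..6}. e j [v] *\<^sub>R E j)] = 0" if i: "i \<in> {1..6}" for i
    proof -
      note l = lin[OF i]
      have "e i [\<Sum>j\<in>{1..6}. e j [v] *\<^sub>R E j] = (\<Sum>j\<in>{1..6}. e j [v] * e i [E j])"
        by (simp only: linear_sum[OF l] linear_scale[OF l] real_scaleR_def)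
      also have "\<dots> = (\<Sum>j\<in>{1..6}. if j = i then e i [v] else 0)"
        by (rule sum.cong) (use dual i in auto)
      finally show ?thesis using i by (simp add: linear_diff[OF l])
    qed
    then have "v - (\<Sum>j\<in>{1..6}. e j [v] *\<^sub>R E j) = 0" by (rule zero)
    then show ?thesis by simp
  qed
  ultimately show thesis by (rule that)
qed

lemma chart_inv_chart:
  "smooth_manifold C \<Longrightarrow> chart_inv C p (chart C p p) = p"
  by (auto simp: smooth_manifold_def homeomorphism_def)

lemma frechet_derivative_chart_at_base:
  assumes "smooth_manifold C"
  shows "frechet_derivative (chart C p \<circ> chart_inv C p) (at (chart C p p)) = id"
proof -
  have p: "p \<in> chart_dom C p" "open (chart_image C p)"
    and hom: "homeomorphism (chart_dom C p) (chart_image C p) (chart C p) (chart_inv C p)"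
    using assms by (auto simp: smooth_manifold_def)
  have "(chart C p \<circ> chart_inv C p has_derivative id) (at (chart C p p))"
  proof (rule has_derivative_transform_within_open[where s = "chart_image C p" and f = id])
    show "chart C p p \<in> chart_image C p" using p by (simp add: chart_image_def)
    show "id x = (chart C p \<circ> chart_inv C p) x" if "x \<in> chart_image C p" for x
      using hom that by (simp add: homeomorphism_def)
  qed (use p in \<open>simp_all add: has_derivative_id\<close>)
  then show ?thesis by (rule frechet_derivative_at[symmetric])
qed

lemma local_rep_at_base:
  "smooth_manifold C \<Longrightarrow> local_rep C T p (chart C p p) = T p"
  by (simp add: local_rep_def Let_def chart_inv_chart frechet_derivative_chart_at_base
      pullback_linear_def)

lemma local_rep_differentiable:
  assumes "smooth_manifold C" "smooth_tensor_field C T"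
  shows "(\<lambda>x. local_rep C T p x vs) differentiable (at (chart C p p))"
proof -
  have "Ck_on (Suc 0) (chart_image C p) (\<lambda>x. local_rep C T p x vs)"
    using assms(2) unfolding smooth_tensor_field_def smooth_on_def by blast
  moreover have "chart C p p \<in> chart_image C p"
    using assms(1) by (auto simp: smooth_manifold_def chart_image_def)
  ultimately show ?thesis by simp
qed

text \<open>The Leibniz rule for \<open>\<omega> = 1/2 \<Sum> c\<^sub>i\<^sub>j e\<^sup>i \<and> e\<^sup>j\<close> with constant coefficients. By antisymmetry of \<open>c\<close> the terms
  differentiating \<open>e\<^sup>j\<close> equal those differentiating \<open>e\<^sup>i\<close>, which absorbs the factor \<open>1/2\<close>.\<close>

lemma ext_deriv_frame_2form:
  fixes C :: "'m::{t2_space, second_countable_topology} charts"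
  assumes M: "smooth_manifold C"
    and e: "\<And>i. i \<in> I \<Longrightarrow> smooth_tensor_field C (e i)" and I: "finite I"
    and c: "\<And>i j. c i j = - c j i"
    and \<omega>: "\<And>q v w. \<omega> q [v, w] = (\<Sum>i\<in>I. \<Sum>j\<in>I. c i j * (e i q [v] * e j q [w]))"
  shows "ext_deriv C \<omega> p [u, v, w] = (\<Sum>i\<in>I. \<Sum>j\<in>I. c i j *
    (ext_deriv C (e i) p [u, v] * e j p [w] - ext_deriv C (e i) p [u, w] * e j p [v]
      + ext_deriv C (e i) p [v, w] * e j p [u]))"
proof -
  define x where "x = chart C p p"
  define A where "A = (\<lambda>i y v. local_rep C (e i) p y [v])"
  define D where "D = (\<lambda>i v u. frechet_derivative (\<lambda>y. A i y v) (at x) u)"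
  define B where "B = (\<lambda>f g. \<Sum>i\<in>I. \<Sum>j\<in>I. c i j * (f i * g j :: real))"
  have Ax: "A i x v = e i p [v]" for i v
    by (simp add: A_def x_def local_rep_at_base[OF M])
  have A: "((\<lambda>y. A i y v) has_derivative (\<lambda>u. D i v u)) (at x)" if "i \<in> I" for i v
    using local_rep_differentiable[OF M e[OF that], of p "[v]"]
    unfolding D_def A_def x_def by (simp add: frechet_derivative_works[symmetric])
  have B_anti: "B f g = - B g f" for f g
  proof -
    have "B f g = (\<Sum>j\<in>I. \<Sum>i\<in>I. c i j * (f i * g j))" unfolding B_def by (rule sum.swap)
    also have "\<dots> = (\<Sum>j\<in>I. \<Sum>i\<in>I. - (c j i * (g j * f i)))"
      by (intro sum.cong refl) (subst c, simp)
    finally show ?thesis by (simp add: B_def sum_negf)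
  qed
  have de: "ext_deriv C (e i) p [v, w] = D i w v - D i v w" for i v w
    by (simp add: ext_deriv_def ext_deriv_local_def lessThan_Suc D_def A_def x_def numeral_2_eq_2)
  have rep: "local_rep C \<omega> p y [v, w] = B (\<lambda>i. A i y v) (\<lambda>j. A j y w)" for y v w
    by (simp add: local_rep_def Let_def pullback_linear_def \<omega> B_def A_def)
  have D\<omega>: "frechet_derivative (\<lambda>y. local_rep C \<omega> p y [v, w]) (at x) u =
      B (\<lambda>i. D i v u) (\<lambda>j. e j p [w]) - B (\<lambda>i. D i w u) (\<lambda>j. e j p [v])" for u v w
  proof -
    have deriv: "((\<lambda>y. local_rep C \<omega> p y [v, w]) has_derivative
      (\<lambda>u. \<Sum>i\<in>I. \<Sum>j\<in>I. c i j * (A i x v * D j w u + D i v u * A j x w))) (at x)"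
      unfolding rep B_def
      by (intro has_derivative_sum has_derivative_mult_right has_derivative_mult A)
    have "frechet_derivative (\<lambda>y. local_rep C \<omega> p y [v, w]) (at x) u =
      (\<Sum>i\<in>I. \<Sum>j\<in>I. c i j * (A i x v * D j w u + D i v u * A j x w))"
      unfolding frechet_derivative_at[OF deriv, symmetric] ..
    also have "\<dots> = B (\<lambda>i. e i p [v]) (\<lambda>j. D j w u) + B (\<lambda>i. D i v u) (\<lambda>j. e j p [w])"
      by (simp add: B_def Ax sum.distrib distrib_left)
    finally show ?thesis by (simp add: B_anti[of "\<lambda>i. e i p [v]" "\<lambda>j. D j w u"])
  qed
  have "ext_deriv C \<omega> p [u, v, w] =
      frechet_derivative (\<lambda>y. local_rep C \<omega> p y [v, w]) (at x) u
      - frechet_derivative (\<lambda>y. local_rep C \<omega> p y [u, w]) (at x) v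
      + frechet_derivative (\<lambda>y. local_rep C \<omega> p y [u, v]) (at x) w"
    by (simp add: ext_deriv_def ext_deriv_local_def x_def lessThan_Suc numeral_2_eq_2)
  also have "\<dots> = (\<Sum>i\<in>I. \<Sum>j\<in>I. c i j *
    (ext_deriv C (e i) p [u, v] * e j p [w] - ext_deriv C (e i) p [u, w] * e j p [v]
      + ext_deriv C (e i) p [v, w] * e j p [u]))"
    unfolding D\<omega> de B_def sum.distrib[symmetric] sum_subtractf[symmetric]
    by (intro sum.cong refl) (simp add: algebra_simps)
  finally show ?thesis .
qed

lemma left_invariant_tangent_map:
  assumes "left_invariant C mul T"
  shows "T p vs = T (mul a p) (map (tangent_map C (mul a) p) vs)"
proof -
  have "pullback C (mul a) T p vs = T p vs" using assms by (simp add: left_invariant_def)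
  then show ?thesis by (simp add: pullback_def pullback_linear_def)
qed


text \<open>Left translations preserve the coframe, hence also the dual frame, and the group acts transitively on
  itself.\<close>

lemma left_invariant_frame_coefficient:
  fixes C :: "'m::{t2_space, second_countable_topology} charts"
  assumes grp: "group mul unit iv" and I: "finite I"
    and e: "\<And>i. i \<in> I \<Longrightarrow> left_invariant C mul (e i)"
    and \<omega>: "left_invariant C mul \<omega>"
    and dual: "\<And>q i j. i \<in> I \<Longrightarrow> j \<in> I \<Longrightarrow> e i q [E q j] = of_bool (i = j)"
    and expand: "\<And>q v. v = (\<Sum>i\<in>I. e i q [v] *\<^sub>R E q i)"
    and ij: "i \<in> I" "j \<in> I"
  shows "\<omega> q [E q i, E q j] = \<omega> unit [E unit i, E unit j]"
proof -
  interpret group mul unit iv by (rule grp)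
  have "tangent_map C (mul q) unit (E unit j) = E q j" if j: "j \<in> I" for j
  proof -
    have "e i q [tangent_map C (mul q) unit (E unit j)] = of_bool (i = j)" if "i \<in> I" for i
      using left_invariant_tangent_map[OF e[OF that], of unit "[E unit j]" q] dual[OF that j]
      by simp
    then have "tangent_map C (mul q) unit (E unit j) = (\<Sum>i\<in>I. of_bool (i = j) *\<^sub>R E q i)"
      using expand[where v = "tangent_map C (mul q) unit (E unit j)" and q = q] by simp
    also have "\<dots> = (\<Sum>i\<in>I. if i = j then E q j else 0)"
      by (rule sum.cong) auto
    finally show ?thesis using j I by simp
  qed
  then show ?thesis
    using left_invariant_tangent_map[OF \<omega>, of unit "[E unit i, E unit j]" q] ij by simp
qed


lemma nikitenko_nikonorov_indices:
  assumes "S \<in> nikitenko_nikonorov r"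
  shows "\<forall>i\<in>{1..6}. \<forall>(c, j, k)\<in>set (S ! (i - 1)). j \<in> {1..6} \<and> k \<in> {1..6}"
  using assms unfolding nikitenko_nikonorov_def atLeastAtMost_1_6
  by (elim insertE emptyE)
    (simp_all add: \<ss>1_def \<ss>5_def \<ss>8_def \<ss>9_def \<ss>10_def \<ss>11_def \<ss>12_def \<ss>13_def)

lemma wedge_1_1:
  assumes "alternating 1 \<alpha>"
  shows "(\<alpha> \<and>\<^sub>f \<beta>) [v, w] = \<alpha> [v] * \<beta> [w] - \<alpha> [w] * \<beta> [v]"
proof -
  have deg: "length vs \<noteq> 1 \<Longrightarrow> \<alpha> vs = 0" for vs by (rule alternating_degree[OF assms])
  have deg0: "length vs \<noteq> 0 \<Longrightarrow> interior_product u \<alpha> vs = 0" for u vs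
    unfolding interior_product_def by (rule deg) simp
  have "interior_product u (interior_product v \<alpha>) = (\<lambda>_. 0)" for u v
    unfolding interior_product_def by (rule ext, rule deg) simp
  then show ?thesis
    using interior_product_wedge[of 1 \<alpha> \<beta> v "[w]", OF deg]
      interior_product_wedge[of 0 "interior_product v \<alpha>" \<beta> w "[]", OF deg0]
      interior_product_wedge[of 1 \<alpha> "interior_product v \<beta>" w "[]", OF deg]
    by (simp add: wedge_Nil wedge_zero_left interior_product_def deg)
qed

lemma structure_equation_on_frame:
  assumes alt: "\<And>i. i \<in> {1..6} \<Longrightarrow> alternating 1 (e i)"
    and dual: "\<And>i j. i \<in> {1..6} \<Longrightarrow> j \<in> {1..6} \<Longrightarrow> e i [E j] = of_bool (i = j)"
    and idx: "\<And>c j k. (c, j, k) \<in> set (S ! (i - 1)) \<Longrightarrow> j \<in> {1..6} \<and> k \<in> {1..6}"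
    and ab: "a \<in> {1..6}" "b \<in> {1..6}"
  shows "(\<Sum>(c, j, k)\<leftarrow>S ! (i - 1). c * (e j \<and>\<^sub>f e k) [E a, E b]) = structure_constant S i a b"
  unfolding structure_constant_def
proof (rule arg_cong[where f = sum_list], rule map_cong[OF refl])
  fix t assume t: "t \<in> set (S ! (i - 1))"
  obtain c j k where cjk: "t = (c, j, k)" by (cases t)
  have jk: "j \<in> {1..6} \<and> k \<in> {1..6}" using t unfolding cjk by (rule idx)
  note j = conjunct1[OF jk] and k = conjunct2[OF jk]
  have "(e j \<and>\<^sub>f e k) [E a, E b] = of_bool (j = a) * of_bool (k = b) - of_bool (j = b) * of_bool (k = a)"
    by (subst wedge_1_1[OF alt[OF j]], subst dual[OF j ab(1)], subst dual[OF j ab(2)],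
        subst dual[OF k ab(1)], subst dual[OF k ab(2)], rule refl)
  then show "(case t of (c, j, k) \<Rightarrow> c * (e j \<and>\<^sub>f e k) [E a, E b]) =
      (case t of (c, j, k) \<Rightarrow> c * (of_bool (j = a \<and> k = b) - of_bool (j = b \<and> k = a)))"
    unfolding cjk by (simp add: of_bool_conj)
qed


section \<open>Nonexistence of coupled structures\<close>

theorem corollary4p8:
  fixes C :: "'m::{t2_space, second_countable_topology} charts"
    and h :: "'m tensor_field"
    and mul :: "'m \<Rightarrow> 'm \<Rightarrow> 'm" and unit :: 'm and iv :: "'m \<Rightarrow> 'm"
    and r :: real and S :: structure_equations
  assumes "smooth_manifold C"
    and "riemannian_metric C h"
    and "connected (UNIV :: 'm set)"
    and "simply_connected (UNIV :: 'm set)"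
    and "homogeneous C h"
    and "einstein C h"
    and "\<not> flat C h"
    and "nonpositive_curvature C h"
    and "r > 0"
    and "S \<in> nikitenko_nikonorov r"
    and "metric_lie_group_with C h mul unit iv S"
  shows "\<not> (\<exists>\<omega> \<psi>. left_invariant C mul \<omega> \<and> left_invariant C mul \<psi> \<and>
           coupled C \<omega> \<psi> \<and> induced_metric \<omega> \<psi> = h)"
proof
  assume "\<exists>\<omega> \<psi>. left_invariant C mul \<omega> \<and> left_invariant C mul \<psi> \<and>
    coupled C \<omega> \<psi> \<and> induced_metric \<omega> \<psi> = h"
  then obtain \<omega> \<psi> where \<omega>_inv: "left_invariant C mul \<omega>" and coupled: "coupled C \<omega> \<psi>"
    and h: "induced_metric \<omega> \<psi> = h" by blast
  obtain c where c: "c unit \<noteq> 0" and d\<omega>: "ext_deriv C \<omega> unit = (\<lambda>vs. c unit * \<psi> unit vs)"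
    using coupled unfolding coupled_def by blast
  have su3: "linear_su3_structure (\<omega> q) (\<psi> q)" for q
    using coupled by (simp add: coupled_def half_flat_def su3_structure_def)
  then have alt: "alternating 2 (\<omega> q)" for q
    by (simp add: linear_su3_structure_def stable_2form_def)
  have grp: "group mul unit iv"
    using assms(11) by (simp add: metric_lie_group_with_def lie_group_def)
  obtain e where e: "\<And>i. i \<in> {1..6} \<Longrightarrow> differential_form C 1 (e i)"
      "\<And>i. i \<in> {1..6} \<Longrightarrow> left_invariant C mul (e i)"
    and he: "\<And>p v w. h p [v, w] = (\<Sum>i=1..6. e i p [v] * e i p [w])"
    and de: "\<And>i p. i \<in> {1..6} \<Longrightarrow> ext_deriv C (e i) p =
           (\<lambda>vs. \<Sum>(c, j, k)\<leftarrow>S ! (i - 1). c * (e j p \<and>\<^sub>f e k p) vs)"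
    using assms(11) unfolding metric_lie_group_with_def by blast
  have e_alt: "alternating 1 (e i q)" if "i \<in> {1..6}" for i q
    using e(1)[OF that] by (simp add: differential_form_def)
  have e_smooth: "smooth_tensor_field C (e i)" if "i \<in> {1..6}" for i
    using e(1)[OF that] by (simp add: differential_form_def)
  have e_lin: "linear (\<lambda>v. e i q [v])" if "i \<in> {1..6}" for i q
    by (rule alternating_linear[OF e_alt[OF that]])
  have "\<exists>E. (\<forall>i\<in>{1..6}. \<forall>j\<in>{1..6}. e i q [E j] = of_bool (i = j)) \<and>
      (\<forall>v. v = (\<Sum>i\<in>{1..6}. e i q [v] *\<^sub>R E i))" for q
  proof -
    have "inner_product (h q)" using assms(2) by (simp add: riemannian_metric_def)
    then show ?thesis
      by (rule dual_frame[where e = "\<lambda>i. e i q", OF _ he e_lin]) blast+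
  qed
  then obtain E where "\<forall>q. (\<forall>i\<in>{1..6}. \<forall>j\<in>{1..6}. e i q [E q j] = of_bool (i = j)) \<and>
      (\<forall>v. v = (\<Sum>i\<in>{1..6}. e i q [v] *\<^sub>R E q i))"
    using choice[of "\<lambda>q E. (\<forall>i\<in>{1..6}. \<forall>j\<in>{1..6}. e i q [E j] = of_bool (i = j)) \<and>
      (\<forall>v. v = (\<Sum>i\<in>{1..6}. e i q [v] *\<^sub>R E i))"] by blast
  then have dual: "\<And>q i j. i \<in> {1..6} \<Longrightarrow> j \<in> {1..6} \<Longrightarrow> e i q [E q j] = of_bool (i = j)"
    and expand: "\<And>q v. v = (\<Sum>i\<in>{1..6}. e i q [v] *\<^sub>R E q i)" by blast+
  define W where "W = (\<lambda>i j. \<omega> unit [E unit i, E unit j])"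
  have W: "\<omega> q [E q i, E q j] = W i j" if "i \<in> {1..6}" "j \<in> {1..6}" for q i j
    unfolding W_def
    by (rule left_invariant_frame_coefficient[OF grp _ e(2) \<omega>_inv dual expand that]) simp
  have \<omega>_frame: "\<omega> q [v, w] = (\<Sum>i\<in>{1..6}. \<Sum>j\<in>{1..6}. W i j * (e i q [v] * e j q [w]))" for q v w
  proof -
    note lin = alternating_2_linear(1,2)[OF alt[of q]]
    have "\<omega> q [v, w] = \<omega> q [\<Sum>i\<in>{1..6}. e i q [v] *\<^sub>R E q i, \<Sum>j\<in>{1..6}. e j q [w] *\<^sub>R E q j]"
      using expand[of v q] expand[of w q] by simp
    also have "\<dots> = (\<Sum>i\<in>{1..6}. e i q [v] * \<omega> q [E q i, \<Sum>j\<in>{1..6}. e j q [w] *\<^sub>R E q j])"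
      by (simp only: linear_sum[OF lin(1)] linear_scale[OF lin(1)] real_scaleR_def)
    also have "\<dots> = (\<Sum>i\<in>{1..6}. \<Sum>j\<in>{1..6}. e i q [v] * (e j q [w] * \<omega> q [E q i, E q j]))"
      by (simp only: linear_sum[OF lin(2)] linear_scale[OF lin(2)] real_scaleR_def sum_distrib_left)
    also have "\<dots> = (\<Sum>i\<in>{1..6}. \<Sum>j\<in>{1..6}. W i j * (e i q [v] * e j q [w]))"
      by (intro sum.cong refl) (simp add: W)
    finally show ?thesis .
  qed
  obtain N A m where root: "dominant_central_root S N A m"
    using nikitenko_nikonorov_dominant_central_root assms(9,10) by blast
  show False
  proof (rule no_coupled_of_dominant_central_root[where E = "E unit" and e = "\<lambda>i. e i unit" and c = "c unit",
        OF su3 root dual expand e_lin _ c])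
    show "su3_metric (\<omega> unit) (\<psi> unit) [v, w] = (\<Sum>i\<in>{1..6}. e i unit [v] * e i unit [w])" for v w
      using fun_cong[OF h, of unit] he by (simp add: induced_metric_def)
    fix a b d :: nat
    assume abd: "a \<in> {1..6}" "b \<in> {1..6}" "d \<in> {1..6}"
    have idx: "j \<in> {1..6} \<and> k \<in> {1..6}" if "i \<in> {1..6}" "(c, j, k) \<in> set (S ! (i - 1))" for i c j k
      using nikitenko_nikonorov_indices[OF assms(10)] that by fast
    have s: "ext_deriv C (e i) unit [E unit a, E unit b] = structure_constant S i a b"
      if "i \<in> {1..6}" "a \<in> {1..6}" "b \<in> {1..6}" for i a b
      unfolding de[OF that(1)]
      by (rule structure_equation_on_frame[OF e_alt dual idx[OF that(1)] that(2,3)])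
    have "c unit * \<psi> unit [E unit a, E unit b, E unit d] = ext_deriv C \<omega> unit [E unit a, E unit b, E unit d]"
      by (simp add: d\<omega>)
    also have "\<dots> = (\<Sum>i\<in>{1..6}. \<Sum>j\<in>{1..6}. W i j *
      (ext_deriv C (e i) unit [E unit a, E unit b] * e j unit [E unit d]
        - ext_deriv C (e i) unit [E unit a, E unit d] * e j unit [E unit b]
        + ext_deriv C (e i) unit [E unit b, E unit d] * e j unit [E unit a]))"
      by (rule ext_deriv_frame_2form[OF assms(1) e_smooth _ _ \<omega>_frame])
        (auto simp: W_def intro: alternating_2_linear(3)[OF alt])
    also have "\<dots> = (\<Sum>i\<in>{1..6}. structure_constant S i a b * \<omega> unit [E unit i, E unit d]
        - structure_constant S i a d * \<omega> unit [E unit i, E unit b]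
        + structure_constant S i b d * \<omega> unit [E unit i, E unit a])"
    proof (rule sum.cong[OF refl])
      fix i :: nat assume i: "i \<in> {1..6}"
      have pick: "(\<Sum>j\<in>{1..6}. W i j * (x * e j unit [E unit k])) = x * W i k" if k: "k \<in> {1..6}" for x k
      proof -
        have "(\<Sum>j\<in>{1..6}. W i j * (x * e j unit [E unit k])) = (\<Sum>j\<in>{1..6}. if j = k then x * W i k else 0)"
          by (rule sum.cong) (use dual k in auto)
        then show ?thesis using k by simp
      qed
      show "(\<Sum>j\<in>{1..6}. W i j *
        (ext_deriv C (e i) unit [E unit a, E unit b] * e j unit [E unit d]
          - ext_deriv C (e i) unit [E unit a, E unit d] * e j unit [E unit b]
          + ext_deriv C (e i) unit [E unit b, E unit d] * e j unit [E unit a])) =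
        structure_constant S i a b * \<omega> unit [E unit i, E unit d]
        - structure_constant S i a d * \<omega> unit [E unit i, E unit b]
        + structure_constant S i b d * \<omega> unit [E unit i, E unit a]"
        unfolding distrib_left right_diff_distrib sum.distrib sum_subtractf pick[OF abd(1)]
          pick[OF abd(2)] pick[OF abd(3)] s[OF i abd(1,2)] s[OF i abd(1,3)] s[OF i abd(2,3)]
        by (simp add: W_def)
    qed
    finally show "c unit * \<psi> unit [E unit a, E unit b, E unit d] =
      (\<Sum>i\<in>{1..6}. structure_constant S i a b * \<omega> unit [E unit i, E unit d]
        - structure_constant S i a d * \<omega> unit [E unit i, E unit b]
        + structure_constant S i b d * \<omega> unit [E unit i, E unit a])" .
  qed
qed

end
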